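(* Let $X=X_1(\varepsilon_1,\varepsilon_2,\lambda)$, $X_2(\nu)$ or $Y(\varepsilon,\kappa)$, where $\varepsilon_1,\varepsilon_2,\varepsilon,\kappa\in\{1,-1\}$, $\lambda,\nu>0$, with transvection group $\hat G=G_L=\mathrm H_5\rtimes\mathbb R$ and stabiliser $\hat G_+=\{0\}\times\mathfrak a_+$. The map $$\Phi:\ X=\hat G/\hat G_+\longrightarrow\mathbb R^4,\qquad t\cdot(z,a)\cdot\hat G_+\longmapsto(v,x,u):=\big(z+\tfrac12\omega_0(a_+,a_-),\,a_-,\,t\big)$$ (with $v,u\in\mathbb R$, $x=(x_1,x_2)\in\mathbb R^2$) is a diffeomorphism. Under it, the action of the transvection group is given by $$t\cdot(z,a)\cdot(v,x,u)=\big(M(z,e^{-uL}a)(v,x),\,u+t\big)$$ for $t\cdot(z,a)\in\hat G$. In particular, the Heisenberg group $\mathrm H_5$ acts by affine transformations on each $u$-level. (i) For $X=X_1(\varepsilon_1,\varepsilon_2,\lambda)$ the metric is $$2\,du\,dv-dx_1^2+dx_2^2+(-\varepsilon_1x_1^2-\varepsilon_2\lambda^2x_2^2)\,du^2.$$ An isometry $(\delta_1,\delta_2,\delta_3)\in\mathrm O(1)\times\mathrm O(1)\times\mathbb Z_2$ acts by $(\delta_1,\delta_2,\delta_3)\cdot(v,x,u)=(\delta_3v,\delta_1\delta_3x_1,\delta_2\delta_3x_2,\delta_3u)$. If, moreover, $\lambda=1$ and $\varepsilon_1=-\varepsilon_2$, then $A\in\mathrm O(1,1)$ acts by $A\cdot(v,x,u)=(v,Ax,u)$.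 (ii) For $X=X_2(\nu)$ the metric is $$2\,du\,dv-dx_1^2+dx_2^2+\big((\nu^2-1)(x_1^2-x_2^2)-4\nu x_1x_2\big)du^2.$$ An isometry $(\delta_1,\delta_2)\in\mathbb Z_2\times\mathbb Z_2$ acts by $(\delta_1,\delta_2)\cdot(v,x,u)=(\delta_2v,\delta_1\delta_2x,\delta_2u)$. (iii) For $X=Y(\varepsilon,\kappa)$ the metric is $$2\,du\,dv-\varepsilon(2\,dx_1dx_2+\kappa\,dx_2^2)+(2x_1x_2-\kappa x_2^2)\,du^2.$$ An isometry $(\delta_1,\delta_2)\in\mathbb Z_2\times\mathbb Z_2$ acts by $(\delta_1,\delta_2)\cdot(v,x,u)=(\delta_2v,\delta_1\delta_2x,\delta_2u)$.
   Context: A symmetric triple $(\hat{\mathfrak g},\theta,\langle\cdot,\cdot\rangle)$ consists of a finite-dimensional real Lie algebra, a non-degenerate $\operatorname{ad}$-invariant symmetric bilinear form, and an involutive isometric automorphism $\theta$ with $[\hat{\mathfrak g}_-,\hat{\mathfrak g}_-]=\hat{\mathfrak g}_+$, where $\hat{\mathfrak g}_\pm$ are the $(\pm1)$-eigenspaces of $\theta$. The associated simply-connected symmetric space is $X=\tilde G/\tilde G_+$ ($\tilde G$ simply-connected with Lie algebra $\hat{\mathfrak g}$, $\tilde G_+$ connected with Lie algebra $\hat{\mathfrak g}_+$) with the $\tilde G$-invariant metric that at the base point $o$ is the restriction of $\langle\cdot,\cdot\rangle$ to $\hat{\mathfrak g}_-\cong T_oX$. The transvection group $\hat G\subset\mathrm{Iso}(X)$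 is generated by all compositions of two point symmetries, has Lie algebra $\hat{\mathfrak g}$, and $X=\hat G/\hat G_+$ with $\hat G_+$ the stabiliser of $o$. $\theta$ also denotes conjugation by the point symmetry at $o$. Triples of $X_1,X_2$: $\hat{\mathfrak g}=\mathbb R\sigma\oplus\mathfrak a\oplus\mathbb Re_1$, $\mathfrak a=\mathbb R^4$, $\theta_{\mathfrak a}=\mathrm{diag}(1,1,-1,-1)$; $\sigma$ central, $[e_1,a]=\rho(a)$, $[a,a']=\langle\rho(a),a'\rangle_{\mathfrak a}\sigma$; $\langle z\sigma+a+te_1,z'\sigma+a'+t'e_1\rangle=\langle a,a'\rangle_{\mathfrak a}+zt'+z't$; $\theta(z\sigma+a+te_1)=-z\sigma+\theta_{\mathfrak a}(a)-te_1$. For $X_1(\varepsilon_1,\varepsilon_2,\lambda)$: $\langle\cdot,\cdot\rangle_{\mathfrak a}=\mathrm{diag}(\varepsilon_1,\varepsilon_2,-1,1)$, $\rho(a)=(\varepsilon_1a_3,-\varepsilon_2\lambda a_4,a_1,\lambda a_2)$. For $X_2(\nu)$: $\langle\cdot,\cdot\rangle_{\mathfrak a}=\mathrm{diag}(-1,1,-1,1)$, $\rho(a)=(-\nu a_3+a_4,a_3+\nu a_4,\nu a_1+a_2,a_1-\nu a_2)$. Triple of $Y(\varepsilon,\kappa)$: $\mathfrak l$ has basis $e_1,e_2,e_3$ with $[e_1,e_2]_{\mathfrak l}=e_3$, $[e_1,e_3]_{\mathfrak l}=-\varepsilon e_2$, $[e_2,e_3]_{\mathfrak l}=0$; $\theta_{\mathfrak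 l}=\mathrm{diag}(-1,-1,1)$; $\gamma$ is the 3-form with $\gamma(e_1,e_2,e_3)=\kappa$; $\hat{\mathfrak g}=\mathfrak l^*\oplus\mathfrak l$, $[\mathfrak l^*,\mathfrak l^*]=0$, $[l,l']=\gamma(l,l',\cdot)+[l,l']_{\mathfrak l}$, $[l,z]=-z([l,\cdot]_{\mathfrak l})$; $\langle z+l,z'+l'\rangle=z(l')+z'(l)$; $\theta=\theta_{\mathfrak l}^*\oplus\theta_{\mathfrak l}$. The group $G_L$: $\omega_0(a,a')=a_1a_3'-a_3a_1'+a_2a_4'-a_4a_2'$ on $\mathbb R^4=\mathfrak a_+\oplus\mathfrak a_-=\mathbb R^2\oplus\mathbb R^2$ (first two / last two coordinates; $a=a_++a_-$). $\mathrm H_5=\mathbb R\times\mathbb R^4$ with $(z,a)(z',a')=(z+z'+\frac12\omega_0(a,a'),a+a')$; $G_L=\mathrm H_5\rtimes\mathbb R$ with $t.(z,a)=(z,e^{tL}a)$; elements are written $(z,a,t)=t\cdot(z,a)$. The transvection groups are identified with $G_L$, $\hat G_+=\{0\}\times\mathfrak a_+$, where - $X_1$: $L(a)=(-\varepsilon_1a_3,-\varepsilon_2\lambda^2a_4,-a_1,a_2)$, the coordinates on $\mathfrak a$ in the triple being replaced by $(-a_1,\lambda a_2,a_3,a_4)$; - $X_2$: $L(a)=((\nu^2-1)a_3-2\nu a_4,-2\nu a_3-(\nu^2-1)a_4,-a_1,a_2)$, the coordinates on $\mathfrak a$ in the triple being replaced by $(-\nu a_1-a_2,a_1-\nu a_2,a_3,a_4)$;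 - $Y$: $L(a)=(a_4,a_3-\kappa a_4,\varepsilon\kappa a_1-\varepsilon a_2,-\varepsilon a_1)$; with $\sigma^i$ the basis of $\mathfrak l^*$ dual to $e_i$, the centre of $\mathrm H_5$ corresponds to $\sigma^1$, the four coordinates $a_1,\dots,a_4$ to the basis $-e_3+\frac\kappa2\sigma^3,\ \sigma^3,\ \varepsilon\sigma^2,\ -e_2+\frac{\varepsilon\kappa}2\sigma^2$, and $t$ to $e_1$. The homomorphism $M:\mathrm H_5\to\mathrm{Aff}(\mathbb R^3)$ is given by $M(z,a)(v,x)=\big(v+\langle a_+,x\rangle_2+z+\frac12\langle a_+,a_-\rangle_2,\ x+a_-\big)$, $(v,x)\in\mathbb R\times\mathbb R^2$, $\langle\cdot,\cdot\rangle_2$ the standard scalar product of $\mathbb R^2$. Isometry groups: $\mathrm{Iso}(X)=\hat G\rtimes P$, where $P$ acts on $\hat G$ by automorphisms $\varphi$ and on $X=\hat G/\hat G_+$ by $g\hat G_+\mapsto\varphi(g)\hat G_+$. For $X_1$: $P=\mathrm O(1,1)\times\mathbb Z_2$ if $\lambda=1,\varepsilon_1\neq\varepsilon_2$, otherwise $P=\mathrm O(1)\times\mathrm O(1)\times\mathbb Z_2$, with $\mathrm O(1)\times\mathrm O(1)\subset\mathrm O(1,1)$ the diagonal matrices; $A\in\mathrm O(1,1)$ (preserving $-x_1^2+x_2^2$) acts by $A.(z,a_++a_-,t)=(z,(A^\top)^{-1}a_++Aa_-,t)$ and the last $\mathbb Z_2$ is generated by $\theta$. For $X_2$ and $Y$: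 $P=\mathbb Z_2\times\mathbb Z_2$, the first factor acting by $\delta.(z,a,t)=(z,\delta a,t)$, $\delta=\pm1$, the second generated by $\theta$. *)

theory Defs
  imports "HOL-Analysis.Analysis" "HOL-Algebra.Left_Coset"
begin

section \<open>Smooth maps between normed vector spaces\<close>

text \<open>The definition is meant for finite-dimensional
  domains and open sets, where f is of class C-(n+1) iff it is differentiable and all its directional
  derivatives are of class C-n.\<close>

fun C_diff_on :: "nat \<Rightarrow> 'a::real_normed_vector set \<Rightarrow> ('a \<Rightarrow> 'b::real_normed_vector) \<Rightarrow> bool" where
  "C_diff_on 0 S f \<longleftrightarrow> continuous_on S f"
| "C_diff_on (Suc n) S f \<longleftrightarrow>
     (\<forall>x\<in>S. f differentiable (at x)) \<and> (\<forall>v. C_diff_on n S (\<lambda>x. frechet_derivative f (at x) v))"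

definition smooth_on :: "'a::real_normed_vector set \<Rightarrow> ('a \<Rightarrow> 'b::real_normed_vector) \<Rightarrow> bool" where
  "smooth_on S f \<longleftrightarrow> (\<forall>n. C_diff_on n S f)"

definition affine_transformation :: "('a::real_vector \<Rightarrow> 'a) \<Rightarrow> bool" where
  "affine_transformation f \<longleftrightarrow> bij f \<and> (\<exists>g c. linear g \<and> (\<forall>y. f y = g y + c))"

type_synonym gcoords = "real \<times> (real^4) \<times> real"
type_synonym xcoords = "real \<times> (real^2) \<times> real"

section \<open>Symmetric triples\<close>

record 'v triple =
  bracket :: "'v \<Rightarrow> 'v \<Rightarrow> 'v"
  form :: "'v \<Rightarrow> 'v \<Rightarrow> real"
  invol :: "'v \<Rightarrow> 'v"

definition plus_part :: "('v::euclidean_space) triple \<Rightarrow> 'v set" where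
  "plus_part T = {\<xi>. invol T \<xi> = \<xi>}"

definition minus_part :: "('v::euclidean_space) triple \<Rightarrow> 'v set" where
  "minus_part T = {\<xi>. invol T \<xi> = - \<xi>}"

definition symmetric_triple :: "('v::euclidean_space) triple \<Rightarrow> bool" where
  "symmetric_triple T \<longleftrightarrow>
     bilinear (bracket T) \<and>
     (\<forall>\<xi>. bracket T \<xi> \<xi> = 0) \<and>
     (\<forall>\<xi> \<eta> \<zeta>. bracket T \<xi> (bracket T \<eta> \<zeta>) + bracket T \<eta> (bracket T \<zeta> \<xi>)
              + bracket T \<zeta> (bracket T \<xi> \<eta>) = 0) \<and>
     bilinear (form T) \<and>
     (\<forall>\<xi> \<eta>. form T \<xi> \<eta> = form T \<eta> \<xi>) \<and>
     (\<forall>\<xi>. (\<forall>\<eta>. form T \<xi> \<eta> = 0) \<longrightarrow> \<xi> = 0) \<and>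
     (\<forall>\<xi> \<eta> \<zeta>. form T (bracket T \<xi> \<eta>) \<zeta> = - form T \<eta> (bracket T \<xi> \<zeta>)) \<and>
     linear (invol T) \<and>
     (\<forall>\<xi>. invol T (invol T \<xi>) = \<xi>) \<and>
     (\<forall>\<xi> \<eta>. invol T (bracket T \<xi> \<eta>) = bracket T (invol T \<xi>) (invol T \<eta>)) \<and>
     (\<forall>\<xi> \<eta>. form T (invol T \<xi>) (invol T \<eta>) = form T \<xi> \<eta>) \<and>
     span {bracket T \<xi> \<eta> |\<xi> \<eta>. \<xi> \<in> minus_part T \<and> \<eta> \<in> minus_part T} = plus_part T"

text \<open>The triple on \<open>\<real>\<sigma> \<oplus> \<real>\<^sup>4 \<oplus> \<real>e\<^sub>1\<close> determined by a scalar product and an endomorphism of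
  \<open>\<real>\<^sup>4\<close>; the element \<open>z\<sigma> + a + te\<^sub>1\<close> is written \<open>(z, a, t)\<close>.\<close>

definition theta_a :: "real^4 \<Rightarrow> real^4" where
  "theta_a a = vector [a$1, a$2, - (a$3), - (a$4)]"

definition oscillator_triple ::
    "(real^4 \<Rightarrow> real^4 \<Rightarrow> real) \<Rightarrow> (real^4 \<Rightarrow> real^4) \<Rightarrow> (gcoords) triple" where
  "oscillator_triple ip \<rho> = \<lparr>
     bracket = (\<lambda>(z, a, t) (z', a', t'). (ip (\<rho> a) a', t *\<^sub>R \<rho> a' - t' *\<^sub>R \<rho> a, 0)),
     form = (\<lambda>(z, a, t) (z', a', t'). ip a a' + z * t' + z' * t),
     invol = (\<lambda>(z, a, t). (- z, theta_a a, - t)) \<rparr>"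

definition diag_form :: "real^4 \<Rightarrow> real^4 \<Rightarrow> real^4 \<Rightarrow> real" where
  "diag_form d a a' = (\<Sum>i\<in>UNIV. d$i * a$i * a'$i)"

definition triple_X1 :: "real \<Rightarrow> real \<Rightarrow> real \<Rightarrow> (gcoords) triple" where
  "triple_X1 \<epsilon>1 \<epsilon>2 lam = oscillator_triple (diag_form (vector [\<epsilon>1, \<epsilon>2, -1, 1]))
     (\<lambda>a. vector [\<epsilon>1 * a$3, - (\<epsilon>2 * lam * a$4), a$1, lam * a$2])"

definition triple_X2 :: "real \<Rightarrow> (gcoords) triple" where
  "triple_X2 \<nu> = oscillator_triple (diag_form (vector [-1, 1, -1, 1]))
     (\<lambda>a. vector [- (\<nu> * a$3) + a$4, a$3 + \<nu> * a$4, \<nu> * a$1 + a$2, a$1 - \<nu> * a$2])"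

text \<open>For \<open>Y\<close> the space is \<open>\<ll>\<^sup>* \<oplus> \<ll>\<close>; a pair \<open>(s, l)\<close> stands for \<open>\<Sum>\<^sub>i s\<^sub>i \<sigma>\<^sup>i + \<Sum>\<^sub>i l\<^sub>i e\<^sub>i\<close>, so that
  the pairing of \<open>\<ll>\<^sup>*\<close> with \<open>\<ll>\<close> is the standard inner product of \<open>\<real>\<^sup>3\<close>.\<close>

definition l_bracket :: "real \<Rightarrow> real^3 \<Rightarrow> real^3 \<Rightarrow> real^3" where
  "l_bracket \<epsilon> l l' =
     (l$1 * l'$2 - l$2 * l'$1) *\<^sub>R axis 3 1 + (l$1 * l'$3 - l$3 * l'$1) *\<^sub>R (- \<epsilon>) *\<^sub>R axis 2 1"

definition l_gamma :: "real \<Rightarrow> real^3 \<Rightarrow> real^3 \<Rightarrow> real^3 \<Rightarrow> real" where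
  "l_gamma \<kappa> l l' l'' = \<kappa> * det (vector [l, l', l''] :: real^3^3)"

text \<open>\<open>l_coad \<epsilon> l s\<close> is the covector \<open>[l, s] = - s([l, \<cdot>])\<close>.\<close>

definition l_coad :: "real \<Rightarrow> real^3 \<Rightarrow> real^3 \<Rightarrow> real^3" where
  "l_coad \<epsilon> l s = (\<chi> i. - (s \<bullet> l_bracket \<epsilon> l (axis i 1)))"

definition theta_l :: "real^3 \<Rightarrow> real^3" where
  "theta_l l = vector [- (l$1), - (l$2), l$3]"

definition triple_Y :: "real \<Rightarrow> real \<Rightarrow> ((real^3) \<times> (real^3)) triple" where
  "triple_Y \<epsilon> \<kappa> = \<lparr>
     bracket = (\<lambda>(s, l) (s', l').
       ((\<chi> i. l_gamma \<kappa> l l' (axis i 1)) + l_coad \<epsilon> l s' - l_coad \<epsilon> l' s, l_bracket \<epsilon> l l')),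
     form = (\<lambda>(s, l) (s', l'). s \<bullet> l' + s' \<bullet> l),
     invol = (\<lambda>(s, l). ((\<chi> i. s \<bullet> theta_l (axis i 1)), theta_l l)) \<rparr>"

section \<open>The groups \<open>H\<^sub>5\<close> and \<open>G\<^sub>L\<close>\<close>

definition a_plus :: "real^4 \<Rightarrow> real^2" where
  "a_plus a = vector [a$1, a$2]"

definition a_minus :: "real^4 \<Rightarrow> real^2" where
  "a_minus a = vector [a$3, a$4]"

definition a_join :: "real^2 \<Rightarrow> real^2 \<Rightarrow> real^4" where
  "a_join x y = vector [x$1, x$2, y$1, y$2]"

definition omega0 :: "real^4 \<Rightarrow> real^4 \<Rightarrow> real" where
  "omega0 a a' = a$1 * a'$3 - a$3 * a'$1 + a$2 * a'$4 - a$4 * a'$2"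

definition H5 :: "(real \<times> (real^4)) monoid" where
  "H5 = \<lparr> carrier = UNIV,
          mult = (\<lambda>(z, a) (z', a'). (z + z' + omega0 a a' / 2, a + a')),
          one = (0, 0) \<rparr>"

text \<open>\<open>exp_op t L = e\<^bsup>tL\<^esup>\<close>.\<close>

definition exp_op :: "real \<Rightarrow> (real^4 \<Rightarrow> real^4) \<Rightarrow> real^4 \<Rightarrow> real^4" where
  "exp_op t L a = (\<Sum>n. (t ^ n / fact n) *\<^sub>R (L ^^ n) a)"

definition flow :: "(real^4 \<Rightarrow> real^4) \<Rightarrow> real \<Rightarrow> real \<times> (real^4) \<Rightarrow> real \<times> (real^4)" where
  "flow L t = (\<lambda>(z, a). (z, exp_op t L a))"

text \<open>The triple \<open>(z, a, t)\<close> denotes the product \<open>t \<cdot> (z, a)\<close>, with the factor from \<open>\<real>\<close> on the left.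
  Hence \<open>(t \<cdot> h)(t' \<cdot> h') = (t + t') \<cdot> ((-t').h)h'\<close>.\<close>

definition G_grp :: "(real^4 \<Rightarrow> real^4) \<Rightarrow> (gcoords) monoid" where
  "G_grp L = \<lparr> carrier = UNIV,
     mult = (\<lambda>(z, a, t) (z', a', t').
       case flow L (- t') (z, a) \<otimes>\<^bsub>H5\<^esub> (z', a') of (z'', a'') \<Rightarrow> (z'', a'', t + t')),
     one = (0, 0, 0) \<rparr>"

definition G_plus :: "(gcoords) set" where
  "G_plus = {(0, a, 0) |a. a_minus a = 0}"

definition L_X1 :: "real \<Rightarrow> real \<Rightarrow> real \<Rightarrow> real^4 \<Rightarrow> real^4" where
  "L_X1 \<epsilon>1 \<epsilon>2 lam a = vector [- (\<epsilon>1 * a$3), - (\<epsilon>2 * lam\<^sup>2 * a$4), - (a$1), a$2]"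

definition L_X2 :: "real \<Rightarrow> real^4 \<Rightarrow> real^4" where
  "L_X2 \<nu> a = vector [(\<nu>\<^sup>2 - 1) * a$3 - 2 * \<nu> * a$4, - (2 * \<nu> * a$3) - (\<nu>\<^sup>2 - 1) * a$4, - (a$1), a$2]"

definition L_Y :: "real \<Rightarrow> real \<Rightarrow> real^4 \<Rightarrow> real^4" where
  "L_Y \<epsilon> \<kappa> a = vector [a$4, a$3 - \<kappa> * a$4, \<epsilon> * \<kappa> * a$1 - \<epsilon> * a$2, - (\<epsilon> * a$1)]"

text \<open>Identification of the Lie algebra of the triple with the tangent space of \<open>G\<^sub>L\<close> at the
  identity, which is \<open>\<real> \<times> \<real>\<^sup>4 \<times> \<real>\<close>.\<close>

definition ident_X1 :: "real \<Rightarrow> gcoords \<Rightarrow> gcoords" where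
  "ident_X1 lam = (\<lambda>(z, a, t). (z, vector [- (a$1), lam * a$2, a$3, a$4], t))"

definition ident_X2 :: "real \<Rightarrow> gcoords \<Rightarrow> gcoords" where
  "ident_X2 \<nu> = (\<lambda>(z, a, t). (z, vector [- (\<nu> * a$1) - a$2, a$1 - \<nu> * a$2, a$3, a$4], t))"

definition ident_Y_inv :: "real \<Rightarrow> real \<Rightarrow> gcoords \<Rightarrow> (real^3) \<times> (real^3)" where
  "ident_Y_inv \<epsilon> \<kappa> = (\<lambda>(z, a, t).
     z *\<^sub>R (axis 1 1, 0)
     + a$1 *\<^sub>R ((\<kappa> / 2) *\<^sub>R axis 3 1, - axis 3 1)
     + a$2 *\<^sub>R (axis 3 1, 0)
     + a$3 *\<^sub>R (\<epsilon> *\<^sub>R axis 2 1, 0)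
     + a$4 *\<^sub>R ((\<epsilon> * \<kappa> / 2) *\<^sub>R axis 2 1, - axis 2 1)
     + t *\<^sub>R (0, axis 1 1))"

definition ident_Y :: "real \<Rightarrow> real \<Rightarrow> (real^3) \<times> (real^3) \<Rightarrow> gcoords" where
  "ident_Y \<epsilon> \<kappa> = inv_into UNIV (ident_Y_inv \<epsilon> \<kappa>)"

text \<open>Bracket of the Lie algebra of \<open>G\<^sub>L\<close>: the Heisenberg algebra of \<open>\<omega>\<^sub>0\<close> extended by the
  derivation \<open>L\<close>.\<close>

definition G_bracket :: "(real^4 \<Rightarrow> real^4) \<Rightarrow> gcoords \<Rightarrow> gcoords
    \<Rightarrow> gcoords" where
  "G_bracket L = (\<lambda>(z, a, t) (z', a', t'). (omega0 a a', t *\<^sub>R L a' - t' *\<^sub>R L a, 0))"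

section \<open>The homogeneous space and its coordinates\<close>

definition X_space :: "(real^4 \<Rightarrow> real^4) \<Rightarrow> (gcoords) set set" where
  "X_space L = lcosets\<^bsub>G_grp L\<^esub> G_plus"

definition proj :: "(real^4 \<Rightarrow> real^4) \<Rightarrow> gcoords \<Rightarrow> (gcoords) set" where
  "proj L p = p <#\<^bsub>G_grp L\<^esub> G_plus"

text \<open>The element \<open>a\<^sub>+\<close> of \<open>\<aa>\<close> is \<open>a_join (a_plus a) 0\<close>, and \<open>a\<^sub>-\<close> is \<open>a_join 0 (a_minus a)\<close>. The use of
  \<open>the_elem\<close> means that \<open>Phi\<close> is meaningful only where the value does not depend on the representative.\<close>

definition Phi :: "(gcoords) set \<Rightarrow> xcoords" where
  "Phi C = the_elem ((\<lambda>(z, a, t).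
     (z + omega0 (a_join (a_plus a) 0) (a_join 0 (a_minus a)) / 2, a_minus a, t)) ` C)"

text \<open>\<open>G/G\<^sub>+\<close> carries the unique smooth structure for which the projection \<open>G \<rightarrow> G/G\<^sub>+\<close> is a submersion.
  A map out of \<open>G/G\<^sub>+\<close> is then smooth iff its composition with the projection is smooth, and a map into
  \<open>G/G\<^sub>+\<close> is smooth iff it locally has smooth lifts to \<open>G\<close>.\<close>

definition smooth_from_X :: "(real^4 \<Rightarrow> real^4) \<Rightarrow>
    ((gcoords) set \<Rightarrow> 'b::real_normed_vector) \<Rightarrow> bool" where
  "smooth_from_X L f \<longleftrightarrow> smooth_on UNIV (\<lambda>p. f (proj L p))"

definition smooth_into_X :: "(real^4 \<Rightarrow> real^4) \<Rightarrow>
    ('b::real_normed_vector \<Rightarrow> (gcoords) set) \<Rightarrow> bool" where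
  "smooth_into_X L g \<longleftrightarrow>
     (\<forall>q. \<exists>U s. open U \<and> q \<in> U \<and> smooth_on U s \<and> (\<forall>r\<in>U. proj L (s r) = g r))"

definition diffeo_X :: "(real^4 \<Rightarrow> real^4) \<Rightarrow>
    ((gcoords) set \<Rightarrow> 'b::real_normed_vector) \<Rightarrow> bool" where
  "diffeo_X L f \<longleftrightarrow> bij_betw f (X_space L) UNIV \<and> smooth_from_X L f
     \<and> smooth_into_X L (inv_into (X_space L) f)"

text \<open>A self-map of \<open>X\<close>, expressed in the coordinates \<open>(v, x, u)\<close>.\<close>

definition in_coords :: "(real^4 \<Rightarrow> real^4) \<Rightarrow>
    ((gcoords) set \<Rightarrow> (gcoords) set) \<Rightarrow>
    xcoords \<Rightarrow> xcoords" where
  "in_coords L F q = Phi (F (inv_into (X_space L) Phi q))"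

text \<open>The action of \<open>G\<close> on \<open>X\<close> by left translations, in coordinates.\<close>

definition G_act :: "(real^4 \<Rightarrow> real^4) \<Rightarrow> gcoords \<Rightarrow>
    xcoords \<Rightarrow> xcoords" where
  "G_act L p = in_coords L (\<lambda>C. p <#\<^bsub>G_grp L\<^esub> C)"

text \<open>The action \<open>gG\<^sub>+ \<mapsto> \<phi>(g)G\<^sub>+\<close> of an automorphism \<open>\<phi>\<close> of \<open>G\<close>, in coordinates.\<close>

definition aut_act :: "(real^4 \<Rightarrow> real^4) \<Rightarrow> (gcoords \<Rightarrow> gcoords) \<Rightarrow>
    xcoords \<Rightarrow> xcoords" where
  "aut_act L \<phi> = in_coords L (\<lambda>C. the_elem ((\<lambda>g. proj L (\<phi> g)) ` C))"

definition M_aff :: "real \<times> (real^4) \<Rightarrow> real \<times> (real^2) \<Rightarrow> real \<times> (real^2)" where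
  "M_aff = (\<lambda>(z, a) (v, x).
     (v + a_plus a \<bullet> x + z + (a_plus a \<bullet> a_minus a) / 2, x + a_minus a))"

section \<open>The metric\<close>

text \<open>A metric on \<open>\<real>\<^sup>4\<close> assigns to each point a bilinear form on the tangent space.\<close>

type_synonym metric = "xcoords \<Rightarrow> xcoords \<Rightarrow> xcoords \<Rightarrow> real"

definition pseudo_riemannian :: "metric \<Rightarrow> bool" where
  "pseudo_riemannian h \<longleftrightarrow>
     (\<forall>q. bilinear (h q) \<and> (\<forall>\<xi> \<eta>. h q \<xi> \<eta> = h q \<eta> \<xi>) \<and> (\<forall>\<xi>. (\<forall>\<eta>. h q \<xi> \<eta> = 0) \<longrightarrow> \<xi> = 0)) \<and>
     (\<forall>\<xi> \<eta>. smooth_on UNIV (\<lambda>q. h q \<xi> \<eta>))"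

definition preserves_metric ::
    "metric \<Rightarrow> (xcoords \<Rightarrow> xcoords) \<Rightarrow> bool" where
  "preserves_metric h F \<longleftrightarrow> (\<forall>q. F differentiable (at q) \<and>
     (\<forall>\<xi> \<eta>. h (F q) (frechet_derivative F (at q) \<xi>) (frechet_derivative F (at q) \<eta>) = h q \<xi> \<eta>))"

definition isometry :: "metric \<Rightarrow> (xcoords \<Rightarrow> xcoords) \<Rightarrow> bool" where
  "isometry h F \<longleftrightarrow> bij F \<and> smooth_on UNIV F \<and> smooth_on UNIV (inv_into UNIV F)
     \<and> preserves_metric h F"

text \<open>\<open>h\<close> is, in the coordinates \<open>\<Phi>\<close>, the \<open>G\<close>-invariant metric of \<open>X\<close> that at the base point is the
  restriction of the form of the triple \<open>T\<close> to its (-1)-eigenspace. That eigenspace is identified with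
  the tangent space of \<open>X\<close> at the base point by the differential of \<open>G \<rightarrow> G/G\<^sub>+\<close> at the identity. As
  \<open>G\<close> acts transitively, these conditions determine \<open>h\<close>.\<close>

definition is_metric_of_X :: "(real^4 \<Rightarrow> real^4) \<Rightarrow> ('v::euclidean_space) triple \<Rightarrow>
    ('v \<Rightarrow> gcoords) \<Rightarrow> metric \<Rightarrow> bool" where
  "is_metric_of_X L T \<iota> h \<longleftrightarrow>
     pseudo_riemannian h \<and>
     (\<forall>p. preserves_metric h (G_act L p)) \<and>
     (let e = \<one>\<^bsub>G_grp L\<^esub>; D = frechet_derivative (\<lambda>p. Phi (proj L p)) (at e) in
       \<forall>\<xi>\<in>minus_part T. \<forall>\<eta>\<in>minus_part T.
         h (Phi (proj L e)) (D (\<iota> \<xi>)) (D (\<iota> \<eta>)) = form T \<xi> \<eta>)"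

text \<open>The three metrics are given by their quadratic forms in \<open>(dv, dx, du)\<close> (with \<open>2 du dv\<close> etc.
  denoting symmetric products); here the polarised bilinear forms are written out.\<close>

definition metric_X1 :: "real \<Rightarrow> real \<Rightarrow> real \<Rightarrow> metric" where
  "metric_X1 \<epsilon>1 \<epsilon>2 lam = (\<lambda>(v, x, u) (dv, dx, du) (dv', dx', du').
     du * dv' + dv * du' - dx$1 * dx'$1 + dx$2 * dx'$2
     + (- \<epsilon>1 * (x$1)\<^sup>2 - \<epsilon>2 * lam\<^sup>2 * (x$2)\<^sup>2) * du * du')"

definition metric_X2 :: "real \<Rightarrow> metric" where
  "metric_X2 \<nu> = (\<lambda>(v, x, u) (dv, dx, du) (dv', dx', du').
     du * dv' + dv * du' - dx$1 * dx'$1 + dx$2 * dx'$2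
     + ((\<nu>\<^sup>2 - 1) * ((x$1)\<^sup>2 - (x$2)\<^sup>2) - 4 * \<nu> * x$1 * x$2) * du * du')"

definition metric_Y :: "real \<Rightarrow> real \<Rightarrow> metric" where
  "metric_Y \<epsilon> \<kappa> = (\<lambda>(v, x, u) (dv, dx, du) (dv', dx', du').
     du * dv' + dv * du' - \<epsilon> * (dx$1 * dx'$2 + dx$2 * dx'$1 + \<kappa> * dx$2 * dx'$2)
     + (2 * x$1 * x$2 - \<kappa> * (x$2)\<^sup>2) * du * du')"

section \<open>The group \<open>P\<close>\<close>

text \<open>Conjugation by the point symmetry at the base point is the Lie group automorphism of \<open>G\<close> whose
  differential at the identity is the involution of the triple.\<close>

definition theta_G :: "(real^4 \<Rightarrow> real^4) \<Rightarrow> ('v::euclidean_space) triple \<Rightarrow>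
    ('v \<Rightarrow> gcoords) \<Rightarrow> gcoords \<Rightarrow> gcoords" where
  "theta_G L T \<iota> = (THE \<phi>. \<phi> \<in> iso (G_grp L) (G_grp L) \<and> smooth_on UNIV \<phi> \<and>
     (\<exists>D. (\<phi> has_derivative D) (at \<one>\<^bsub>G_grp L\<^esub>) \<and> (\<forall>\<xi>. D (\<iota> \<xi>) = \<iota> (invol T \<xi>))))"

text \<open>The element \<open>\<delta> = \<plusminus>1\<close> of the factor \<open>\<int>\<^sub>2\<close> generated by \<open>\<theta>\<close>.\<close>

definition theta_pow :: "(real^4 \<Rightarrow> real^4) \<Rightarrow> ('v::euclidean_space) triple \<Rightarrow>
    ('v \<Rightarrow> gcoords) \<Rightarrow> real \<Rightarrow> gcoords \<Rightarrow> gcoords" where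
  "theta_pow L T \<iota> \<delta> = (if \<delta> = -1 then theta_G L T \<iota> else id)"

definition O11 :: "(real^2^2) set" where
  "O11 = {A. \<forall>x. - ((A *v x)$1)\<^sup>2 + ((A *v x)$2)\<^sup>2 = - (x$1)\<^sup>2 + (x$2)\<^sup>2}"

definition matrix_aut :: "real^2^2 \<Rightarrow> gcoords \<Rightarrow> gcoords" where
  "matrix_aut A = (\<lambda>(z, a, t).
     (z, a_join (matrix_inv (transpose A) *v a_plus a) (A *v a_minus a), t))"

definition diag2 :: "real \<Rightarrow> real \<Rightarrow> real^2^2" where
  "diag2 \<delta>1 \<delta>2 = vector [vector [\<delta>1, 0], vector [0, \<delta>2]]"

definition sign_aut :: "real \<Rightarrow> gcoords \<Rightarrow> gcoords" where
  "sign_aut \<delta> = (\<lambda>(z, a, t). (z, \<delta> *\<^sub>R a, t))"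

section \<open>Consistency of the data\<close>

text \<open>The three triples are symmetric triples, and the identifications are isomorphisms onto the Lie
  algebra of \<open>G\<^sub>L\<close>.\<close>

lemma vector_4_nth [simp]: "(vector [x,y,z,w] :: 'a::zero^4)$1 = x" "(vector [x,y,z,w] :: 'a^4)$2 = y"
 "(vector [x,y,z,w] :: 'a^4)$3 = z" "(vector [x,y,z,w] :: 'a^4)$4 = w"
  unfolding vector_def by auto

lemma lie_iso_ident_X1: assumes "\<epsilon>1 \<in> {1,-1}" "\<epsilon>2 \<in> {1,-1}" "lam > 0"
  shows "linear (ident_X1 lam)" "bij (ident_X1 lam)"
    "ident_X1 lam (bracket (triple_X1 \<epsilon>1 \<epsilon>2 lam) \<xi> \<eta>) = G_bracket (L_X1 \<epsilon>1 \<epsilon>2 lam) (ident_X1 lam \<xi>) (ident_X1 lam \<eta>)"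
proof -
  show "linear (ident_X1 lam)"
    by (rule linearI) (auto simp: ident_X1_def vec_eq_iff forall_4 algebra_simps)
  have "ident_X1 lam ((\<lambda>(z,a,t). (z, vector [- (a$1), a$2/lam, a$3,a$4], t)) y) = y" for y
    using assms by (cases y) (auto simp: ident_X1_def vec_eq_iff forall_4)
  moreover have "(\<lambda>(z,a,t). (z, vector [- (a$1), a$2/lam, a$3,a$4], t)) (ident_X1 lam y) = y" for y
    using assms by (cases y) (auto simp: ident_X1_def vec_eq_iff forall_4)
  ultimately show "bij (ident_X1 lam)" by (intro bij_betw_byWitness[where f' = "\<lambda>(z,a,t). (z, vector [- (a$1), a$2/lam, a$3,a$4], t)"]) blast+
  show "ident_X1 lam (bracket (triple_X1 \<epsilon>1 \<epsilon>2 lam) \<xi> \<eta>) = G_bracket (L_X1 \<epsilon>1 \<epsilon>2 lam) (ident_X1 lam \<xi>) (ident_X1 lam \<eta>)"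
    using assms by (cases \<xi>, cases \<eta>) (auto simp: ident_X1_def triple_X1_def oscillator_triple_def
      G_bracket_def L_X1_def omega0_def diag_form_def sum_4 vec_eq_iff forall_4 algebra_simps power2_eq_square)
qed

lemma lie_iso_ident_X2: assumes  "\<nu> > 0"
  shows "linear (ident_X2 \<nu>)" "bij (ident_X2 \<nu>)"
    "ident_X2 \<nu> (bracket (triple_X2 \<nu>) \<xi> \<eta>) = G_bracket (L_X2 \<nu>) (ident_X2 \<nu> \<xi>) (ident_X2 \<nu> \<eta>)"
proof -
  show l: "linear (ident_X2 \<nu>)"
    by (rule linearI) (auto simp: ident_X2_def vec_eq_iff forall_4 algebra_simps)
  have n: "\<nu>\<^sup>2 + 1 > 0" by (simp add: add_nonneg_pos)
  have "x = 0" if h: "ident_X2 \<nu> x = 0" for x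
  proof -
    obtain z a t where x: "x = (z,a,t)" by (cases x) auto
    have e: "\<nu> * a$1 + a$2 = 0" "a$1 = \<nu> * a$2" "a$3 = 0" "a$4 = 0" "z = 0" "t = 0"
      using h by (auto simp: x ident_X2_def zero_prod_def vec_eq_iff forall_4)
    have "(\<nu>\<^sup>2+1) * a$2 = 0" using e(1,2) by (simp add: algebra_simps power2_eq_square)
    then show ?thesis using e n by (auto simp: x zero_prod_def vec_eq_iff forall_4)
  qed
  then have "inj (ident_X2 \<nu>)" using l linear_injective_0 by blast
  then show "bij (ident_X2 \<nu>)" using l linear_injective_imp_surjective by (blast intro: bijI)
  show "ident_X2 \<nu> (bracket (triple_X2 \<nu>) \<xi> \<eta>) = G_bracket (L_X2 \<nu>) (ident_X2 \<nu> \<xi>) (ident_X2 \<nu> \<eta>)"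
    by (cases \<xi>, cases \<eta>) (simp add: ident_X2_def triple_X2_def oscillator_triple_def G_bracket_def
      L_X2_def omega0_def diag_form_def sum_4 vec_eq_iff forall_4 algebra_simps power2_eq_square)
qed

lemma lie_iso_ident_Y: assumes "\<epsilon> \<in> {1,-1}" 
  shows "linear (ident_Y_inv \<epsilon> \<kappa>)" "bij (ident_Y_inv \<epsilon> \<kappa>)"
    "ident_Y_inv \<epsilon> \<kappa> (G_bracket (L_Y \<epsilon> \<kappa>) x y) = bracket (triple_Y \<epsilon> \<kappa>) (ident_Y_inv \<epsilon> \<kappa> x) (ident_Y_inv \<epsilon> \<kappa> y)"
proof -
  show l: "linear (ident_Y_inv \<epsilon> \<kappa>)"
    by (rule linearI) (auto simp: ident_Y_inv_def vec_eq_iff forall_3 axis_def algebra_simps add_divide_distrib)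
  have "x = 0" if h: "ident_Y_inv \<epsilon> \<kappa> x = 0" for x
    using h assms by (cases x) (auto simp: ident_Y_inv_def zero_prod_def vec_eq_iff forall_4 forall_3 axis_def)
  then have i: "inj (ident_Y_inv \<epsilon> \<kappa>)" using l linear_injective_0 by blast
  have "surj (ident_Y_inv \<epsilon> \<kappa>)"
  proof (rule surjI)
    fix y :: "(real^3) \<times> (real^3)"
    obtain s k where y: "y = (s,k)" by force
    show "ident_Y_inv \<epsilon> \<kappa> ((\<lambda>(s,k). (s$1, vector [- (k$3), s$3 + \<kappa>/2 * k$3, \<epsilon> * s$2 + \<kappa>/2 * k$2, - (k$2)], k$1)) y) = y"
      using assms by (auto simp: y ident_Y_inv_def vec_eq_iff forall_3 axis_def algebra_simps)
  qed
  then show "bij (ident_Y_inv \<epsilon> \<kappa>)" using i by (blast intro: bijI)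
  show "ident_Y_inv \<epsilon> \<kappa> (G_bracket (L_Y \<epsilon> \<kappa>) x y) = bracket (triple_Y \<epsilon> \<kappa>) (ident_Y_inv \<epsilon> \<kappa> x) (ident_Y_inv \<epsilon> \<kappa> y)"
  proof -
    obtain z a t z' a' t' where xy: "x = (z, a, t)" "y = (z', a', t')" by (cases x, cases y) auto
    have "\<epsilon> = 1 \<or> \<epsilon> = -1" using assms by auto
    then show ?thesis
      by (elim disjE; simp add: xy ident_Y_inv_def triple_Y_def G_bracket_def L_Y_def omega0_def l_bracket_def
        l_coad_def l_gamma_def det_3 axis_def inner_vec_def sum_3 vec_eq_iff forall_3; simp add: field_simps)
  qed
qed

lemma span_eqI:
  fixes S :: "'v::euclidean_space set"
  assumes "\<And>x. x \<in> S \<Longrightarrow> x \<in> P" "subspace P" "\<And>x. x \<in> P \<Longrightarrow> x \<in> span S"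
  shows "span S = P"
  using assms by (metis span_minimal subsetI subset_antisym)

lemma bilinear_by_eqs: assumes "\<And>x y z. f (x+y) z = f x z + f y z" "\<And>x y z. f x (y+z) = f x y + f x z"
  "\<And>c x y. f (c *\<^sub>R x) y = c *\<^sub>R f x y" "\<And>c x y. f x (c *\<^sub>R y) = c *\<^sub>R f x y"
  shows "bilinear f" unfolding bilinear_def by (auto intro!: linearI assms)

lemma symmetric_triple_X1: assumes "\<epsilon>1 \<in> {1,-1}" "\<epsilon>2 \<in> {1,-1}" "lam > 0"
  shows "symmetric_triple (triple_X1 \<epsilon>1 \<epsilon>2 lam)"
proof -
  let ?T = "triple_X1 \<epsilon>1 \<epsilon>2 lam"
  note d = triple_X1_def oscillator_triple_def diag_form_def sum_4 vec_eq_iff forall_4 theta_a_def zero_prod_def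
  have 1: "bilinear (bracket ?T)" by (rule bilinear_by_eqs) (auto simp: d algebra_simps)
  have 2: "bilinear (form ?T)" by (rule bilinear_by_eqs) (auto simp: d algebra_simps)
  have 3: "linear (invol ?T)" by (rule linearI) (auto simp: d algebra_simps)
  have 4: "\<xi> = 0" if h: "\<forall>\<eta>. form ?T \<xi> \<eta> = 0" for \<xi>
  proof -
    obtain z a t where x: "\<xi> = (z,a,t)" by (cases \<xi>) auto
    have "z = 0" "t = 0" "a$1 = 0" "a$2 = 0" "a$3 = 0" "a$4 = 0"
      using assms h[rule_format, of "(0,0,1)"] h[rule_format, of "(1,0,0)"] h[rule_format, of "(0,axis 1 1,0)"]
       h[rule_format, of "(0,axis 2 1,0)"] h[rule_format, of "(0,axis 3 1,0)"] h[rule_format, of "(0,axis 4 1,0)"]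
      by (auto simp: x d axis_def)
    then show ?thesis by (auto simp: x d)
  qed
  have 5: "form ?T (bracket ?T \<xi> \<eta>) \<zeta> = - form ?T \<eta> (bracket ?T \<xi> \<zeta>)" for \<xi> \<eta> \<zeta>
    using assms by (cases \<xi>, cases \<eta>, cases \<zeta>) (auto simp: d algebra_simps)
  have 6: "span {bracket ?T \<xi> \<eta> |\<xi> \<eta>. \<xi> \<in> minus_part ?T \<and> \<eta> \<in> minus_part ?T} = plus_part ?T" (is "span ?S = _")
  proof (rule span_eqI)
    show "x \<in> plus_part ?T" if "x \<in> ?S" for x using that
      by (auto simp: plus_part_def minus_part_def d)
    show "subspace (plus_part ?T)"
      by (auto simp: subspace_def plus_part_def d)
    fix x assume x: "x \<in> plus_part ?T"
    obtain z a t where xx: "x = (z,a,t)" by (cases x) auto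
    let ?f = "(0,0,1) :: gcoords"
    let ?g = "(0, axis 3 (\<epsilon>1 * a$1) + axis 4 (-\<epsilon>2/lam * a$2) ,0) :: gcoords"
    have "?f \<in> minus_part ?T" "?g \<in> minus_part ?T" by (auto simp: minus_part_def d axis_def)
    moreover have "x = bracket ?T ?f ?g" using x assms by (auto simp: xx plus_part_def d axis_def)
    ultimately have "x \<in> ?S" by blast
    then show "x \<in> span ?S" by (rule span_base)
  qed
  show ?thesis unfolding symmetric_triple_def
    using 1 2 3 4 5 6 assms
    by (auto simp: d algebra_simps)
qed

lemma symmetric_triple_X2: assumes "\<nu> > 0"
  shows "symmetric_triple (triple_X2 \<nu>)"
proof -
  let ?T = "triple_X2 \<nu>"
  note d = triple_X2_def oscillator_triple_def diag_form_def sum_4 vec_eq_iff forall_4 theta_a_def zero_prod_def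
  have 1: "bilinear (bracket ?T)" by (rule bilinear_by_eqs) (auto simp: d algebra_simps)
  have 2: "bilinear (form ?T)" by (rule bilinear_by_eqs) (auto simp: d algebra_simps)
  have 3: "linear (invol ?T)" by (rule linearI) (auto simp: d algebra_simps)
  have 4: "\<xi> = 0" if h: "\<forall>\<eta>. form ?T \<xi> \<eta> = 0" for \<xi>
  proof -
    obtain z a t where x: "\<xi> = (z,a,t)" by (cases \<xi>) auto
    have "z = 0" "t = 0" "a$1 = 0" "a$2 = 0" "a$3 = 0" "a$4 = 0"
      using assms h[rule_format, of "(0,0,1)"] h[rule_format, of "(1,0,0)"] h[rule_format, of "(0,axis 1 1,0)"]
       h[rule_format, of "(0,axis 2 1,0)"] h[rule_format, of "(0,axis 3 1,0)"] h[rule_format, of "(0,axis 4 1,0)"]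
      by (auto simp: x d axis_def)
    then show ?thesis by (auto simp: x d)
  qed
  have 5: "form ?T (bracket ?T \<xi> \<eta>) \<zeta> = - form ?T \<eta> (bracket ?T \<xi> \<zeta>)" for \<xi> \<eta> \<zeta>
    using assms by (cases \<xi>, cases \<eta>, cases \<zeta>) (auto simp: d algebra_simps)
  have 6: "span {bracket ?T \<xi> \<eta> |\<xi> \<eta>. \<xi> \<in> minus_part ?T \<and> \<eta> \<in> minus_part ?T} = plus_part ?T" (is "span ?S = _")
  proof (rule span_eqI)
    show "x \<in> plus_part ?T" if "x \<in> ?S" for x using that
      by (auto simp: plus_part_def minus_part_def d)
    show "subspace (plus_part ?T)"
      by (auto simp: subspace_def plus_part_def d)
    fix x assume x: "x \<in> plus_part ?T"
    obtain z a t where xx: "x = (z,a,t)" by (cases x) auto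
    have n: "\<nu>\<^sup>2 + 1 > 0" by (simp add: add_nonneg_pos)
    define p where "p = (- \<nu> * a$1 + a$2) / (\<nu>\<^sup>2 + 1)"
    define q where "q = (a$1 + \<nu> * a$2) / (\<nu>\<^sup>2 + 1)"
    have pq: "- (\<nu> * p) + q = a$1" "p + \<nu> * q = a$2" using n unfolding p_def q_def
      by (simp_all add: divide_simps) (simp_all add: algebra_simps power2_eq_square)
    let ?f = "(0,0,1) :: gcoords"
    let ?g = "(0, axis 3 p + axis 4 q ,0) :: gcoords"
    have "?f \<in> minus_part ?T" "?g \<in> minus_part ?T" by (auto simp: minus_part_def d axis_def)
    moreover have "x = bracket ?T ?f ?g" using x assms pq by (auto simp: xx plus_part_def d axis_def)
    ultimately have "x \<in> ?S" by blast
    then show "x \<in> span ?S" by (rule span_base)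
  qed
  show ?thesis unfolding symmetric_triple_def
    using 1 2 3 4 5 6 assms
    by (auto simp: d algebra_simps)
qed

lemma symmetric_triple_Y: assumes "\<epsilon> \<in> {1,-1}" "\<kappa> \<in> {1,-1}"
  shows "symmetric_triple (triple_Y \<epsilon> \<kappa>)"
proof -
  let ?T = "triple_Y \<epsilon> \<kappa>"
  note d = triple_Y_def l_bracket_def l_coad_def l_gamma_def theta_l_def det_3 axis_def inner_vec_def sum_3 vec_eq_iff forall_3 zero_prod_def
  have 1: "bilinear (bracket ?T)" by (rule bilinear_by_eqs) (auto simp: d algebra_simps)
  have 2: "bilinear (form ?T)" by (rule bilinear_by_eqs) (auto simp: d algebra_simps)
  have 3: "linear (invol ?T)" by (rule linearI) (auto simp: d algebra_simps)
  have 4: "\<xi> = 0" if h: "\<forall>\<eta>. form ?T \<xi> \<eta> = 0" for \<xi>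
  proof -
    have "form ?T \<xi> (snd \<xi>, fst \<xi>) = 0" using h by blast
    then have "fst \<xi> \<bullet> fst \<xi> + snd \<xi> \<bullet> snd \<xi> = 0" by (cases \<xi>) (auto simp: triple_Y_def)
    then show ?thesis by (metis add_nonneg_eq_0_iff inner_eq_zero_iff inner_ge_zero prod.collapse zero_prod_def)
  qed
  have 5: "form ?T (bracket ?T \<xi> \<eta>) \<zeta> = - form ?T \<eta> (bracket ?T \<xi> \<zeta>)" for \<xi> \<eta> \<zeta>
    using assms by (cases \<xi>, cases \<eta>, cases \<zeta>) (auto simp: d algebra_simps)
  have 6: "span {bracket ?T \<xi> \<eta> |\<xi> \<eta>. \<xi> \<in> minus_part ?T \<and> \<eta> \<in> minus_part ?T} = plus_part ?T" (is "span ?S = _")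
  proof (rule span_eqI)
    show "x \<in> plus_part ?T" if "x \<in> ?S" for x using that
      by (auto simp: plus_part_def minus_part_def d)
    show "subspace (plus_part ?T)"
      by (auto simp: subspace_def plus_part_def d)
    fix x assume x: "x \<in> plus_part ?T"
    obtain s l where xx: "x = (s,l)" by (cases x) auto
    let ?f = "(0, axis 1 1) :: (real^3)\<times>(real^3)"
    let ?g = "(axis 2 (\<epsilon> * (s$3 - \<kappa> * l$3)), axis 2 (l$3)) :: (real^3)\<times>(real^3)"
    have "?f \<in> minus_part ?T" "?g \<in> minus_part ?T" by (auto simp: minus_part_def d)
    moreover have "x = bracket ?T ?f ?g" using x assms by (auto simp: xx plus_part_def d algebra_simps)
    ultimately have "x \<in> ?S" by blast
    then show "x \<in> span ?S" by (rule span_base)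
  qed
  have 7: "bracket ?T \<xi> (bracket ?T \<eta> \<zeta>) + bracket ?T \<eta> (bracket ?T \<zeta> \<xi>)
              + bracket ?T \<zeta> (bracket ?T \<xi> \<eta>) = 0" for \<xi> \<eta> \<zeta>
    using assms by (cases \<xi>, cases \<eta>, cases \<zeta>) (auto simp: d algebra_simps)
  have 8: "bracket ?T \<xi> \<xi> = 0" for \<xi> by (cases \<xi>) (auto simp: d algebra_simps)
  have 9: "form ?T \<xi> \<eta> = form ?T \<eta> \<xi>" for \<xi> \<eta>  by (cases \<xi>, cases \<eta>) (auto simp: d algebra_simps)
  have 10: "invol ?T (invol ?T \<xi>) = \<xi>" for \<xi> by (cases \<xi>) (auto simp: d algebra_simps)
  have 11: "invol ?T (bracket ?T \<xi> \<eta>) = bracket ?T (invol ?T \<xi>) (invol ?T \<eta>)" for \<xi> \<eta>  by (cases \<xi>, cases \<eta>) (auto simp: d algebra_simps)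
  have 12: "form ?T (invol ?T \<xi>) (invol ?T \<eta>) = form ?T \<xi> \<eta>" for \<xi> \<eta>  by (cases \<xi>, cases \<eta>) (auto simp: d algebra_simps)
  show ?thesis unfolding symmetric_triple_def
    using 1 2 3 4 5 6 7 8 9 10 11 12 by blast
qed

end

(* All three operators have the form L(a) = S(a_-) + T(a_+) with S and T symmetric, so L lies in
   sp(omega_0), and the three metrics have the form 2 du dv + g(dx, dx) + <S x, x> du^2 with
   g = T^(-1).  For b(u) = e^(-uL) a the translation by t.(z, a) is
   (v, x, u) |-> (v + <b_+, x> + z + <b_+, b_-> / 2, x + b_-, u + t), and b' = -L b, i.e.
   b_+' = -S b_- and b_-' = -T b_+, is exactly what makes it preserve the metric.
   The automorphism theta of G_L is (z, a, t) |-> (-z, theta_a a, -t), since a smooth homomorphism is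
   determined by its differential at the identity. *)
theory Submission
  imports Defs
begin

section \<open>Smooth maps\<close>

text \<open>The flow enters through \<open>b = exp_op (- u) L a\<close> because moving
  \<open>(z, a, t)\<close> past the factor \<open>u\<close> of the base point applies the flow
  backwards. The laws of the flow (inverse, additivity, intertwining, invariance of
  \<open>omega0\<close>) are obtained by exhibiting a quantity with zero derivative, not by
  multiplying series. Smoothness is asked only of polynomial maps: the coset coordinates, their
  section, the metric coefficients, and linear automorphisms and isometries. The translations, which
  contain the exponential, have to be differentiable once. The main obstacle is that
  \<open>theta_G\<close> is a definite description: besides checking that the expected map is an
  automorphism, every competitor with the same differential has to be identified. Its components
  along a one-parameter subgroup satisfy additive laws twisted by the flow, and a known velocity at
  0 determines them.\<close>

lemma C_diff_on_SucI:
  assumes "\<And>x. (f has_derivative f' x) (at x)" and "\<And>v. C_diff_on n UNIV (\<lambda>x. f' x v)"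
  shows "C_diff_on (Suc n) UNIV f"
proof -
  \<comment> \<open>\<open>frechet_derivative\<close> is a choice operator; uniqueness of
    derivatives replaces it by the given family.\<close>
  have "frechet_derivative f (at x) = f' x" for x
    using frechet_derivative_at[OF assms(1)[of x]] by simp
  then show ?thesis
    using assms by (auto simp: differentiable_def)
qed

lemma C_diff_on_SucE:
  assumes "C_diff_on (Suc n) UNIV f"
  obtains f' where "\<And>x. (f has_derivative f' x) (at x)" and "\<And>v. C_diff_on n UNIV (\<lambda>x. f' x v)"
proof
  show "(f has_derivative frechet_derivative f (at x)) (at x)" for x
    using assms by (auto simp: frechet_derivative_works)
  show "C_diff_on n UNIV (\<lambda>x. frechet_derivative f (at x) v)" for v
    using assms by auto
qed

text \<open>The Leibniz rule leaves one factor undifferentiated, so its induction step needs that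
  factor at the lower order too.\<close>

lemma C_diff_on_mono: "C_diff_on (Suc n) UNIV f \<Longrightarrow> C_diff_on n UNIV f"
proof (induction n arbitrary: f)
  case 0
  then show ?case
    by (auto simp: continuous_on_eq_continuous_within differentiable_imp_continuous_within)
next
  case (Suc n)
  then show ?case
    by (metis C_diff_on.simps(2))
qed

lemma C_diff_on_const: "C_diff_on n UNIV (\<lambda>x. c)"
  by (induction n arbitrary: c) (auto simp: continuous_on_const)

lemma C_diff_on_bounded_linear: "bounded_linear f \<Longrightarrow> C_diff_on n UNIV f"
  by (cases n) (auto intro!: C_diff_on_SucI[where f' = "\<lambda>x. f"] C_diff_on_const
      bounded_linear_imp_has_derivative linear_continuous_on simp del: C_diff_on.simps(2))

lemma C_diff_on_add:
  "C_diff_on n UNIV f \<Longrightarrow> C_diff_on n UNIV g \<Longrightarrow> C_diff_on n UNIV (\<lambda>x. f x + g x)"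
proof (induction n arbitrary: f g)
  case 0
  then show ?case by (auto intro: continuous_on_add)
next
  case (Suc n)
  obtain f' g' where "\<And>x. (f has_derivative f' x) (at x)" "\<And>v. C_diff_on n UNIV (\<lambda>x. f' x v)"
    "\<And>x. (g has_derivative g' x) (at x)" "\<And>v. C_diff_on n UNIV (\<lambda>x. g' x v)"
    using Suc.prems by (metis C_diff_on_SucE)
  then show ?case
    by (intro C_diff_on_SucI[where f' = "\<lambda>x v. f' x v + g' x v"] Suc.IH has_derivative_add)
qed

lemma (in bounded_bilinear) C_diff_on_prod:
  "C_diff_on n UNIV f \<Longrightarrow> C_diff_on n UNIV g \<Longrightarrow> C_diff_on n UNIV (\<lambda>x. prod (f x) (g x))"
proof (induction n arbitrary: f g)
  case 0
  then show ?case by (auto intro: continuous_on)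
next
  case (Suc n)
  obtain f' g' where d: "\<And>x. (f has_derivative f' x) (at x)" "\<And>v. C_diff_on n UNIV (\<lambda>x. f' x v)"
    "\<And>x. (g has_derivative g' x) (at x)" "\<And>v. C_diff_on n UNIV (\<lambda>x. g' x v)"
    using Suc.prems by (metis C_diff_on_SucE)
  then show ?case
    using C_diff_on_mono[OF Suc.prems(1)] C_diff_on_mono[OF Suc.prems(2)]
    by (intro C_diff_on_SucI[where f' = "\<lambda>x v. prod (f x) (g' x v) + prod (f' x v) (g x)"]
        C_diff_on_add Suc.IH FDERIV)
qed

lemma C_diff_on_linear_compose:
  assumes "bounded_linear A"
  shows "C_diff_on n UNIV f \<Longrightarrow> C_diff_on n UNIV (\<lambda>x. A (f x))"
proof (induction n arbitrary: f)
  case 0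
  then show ?case by (auto intro: bounded_linear.continuous_on[OF assms])
next
  case (Suc n)
  obtain f' where "\<And>x. (f has_derivative f' x) (at x)" "\<And>v. C_diff_on n UNIV (\<lambda>x. f' x v)"
    using Suc.prems by (metis C_diff_on_SucE)
  then show ?case
    by (intro C_diff_on_SucI[where f' = "\<lambda>x v. A (f' x v)"] Suc.IH
        bounded_linear.has_derivative[OF assms])
qed

lemma smooth_on_const: "smooth_on UNIV (\<lambda>x. c)"
  by (simp add: smooth_on_def C_diff_on_const)

lemma smooth_on_bounded_linear: "bounded_linear f \<Longrightarrow> smooth_on UNIV f"
  by (simp add: smooth_on_def C_diff_on_bounded_linear)

lemma smooth_on_linear: "linear f \<Longrightarrow> smooth_on UNIV f"
  for f :: "'a::euclidean_space \<Rightarrow> 'b::real_normed_vector"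
  by (simp add: smooth_on_bounded_linear linear_conv_bounded_linear)

lemma smooth_on_add:
  "smooth_on UNIV f \<Longrightarrow> smooth_on UNIV g \<Longrightarrow> smooth_on UNIV (\<lambda>x. f x + g x)"
  by (simp add: smooth_on_def C_diff_on_add)

lemma (in bounded_bilinear) smooth_on_prod:
  "smooth_on UNIV f \<Longrightarrow> smooth_on UNIV g \<Longrightarrow> smooth_on UNIV (\<lambda>x. prod (f x) (g x))"
  by (simp add: smooth_on_def C_diff_on_prod)

text \<open>A pair is the sum of its two coordinate embeddings, which reduces pairing to sums and
  linear maps; \<open>add_Pair\<close> must not merge the sum again.\<close>

lemma smooth_on_Pair:
  assumes "smooth_on UNIV f" "smooth_on UNIV g"
  shows "smooth_on UNIV (\<lambda>x. (f x, g x))"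
proof -
  have "smooth_on UNIV (\<lambda>x. (f x, 0) + (0, g x))"
    using assms
    by (auto simp: smooth_on_def simp del: add_Pair intro!: C_diff_on_add
        C_diff_on_linear_compose[of "\<lambda>y. (y, 0)"] C_diff_on_linear_compose[of "\<lambda>y. (0, y)"]
        bounded_linear_Pair bounded_linear_ident bounded_linear_zero)
  then show ?thesis by simp
qed

section \<open>The exponential of an endomorphism\<close>

lemma exp_op_summable:
  fixes L :: "real^4 \<Rightarrow> real^4"
  assumes "linear L"
  shows "summable (\<lambda>n. (t ^ n / fact n) *\<^sub>R (L ^^ n) a)"
proof -
  obtain K where K: "K > 0" "\<And>x. norm (L x) \<le> K * norm x"
    using linear_bounded_pos[OF assms] by auto
  have b: "norm ((L ^^ n) a) \<le> K ^ n * norm a" for n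
  proof (induction n)
    case (Suc n)
    have "norm ((L ^^ Suc n) a) \<le> K * norm ((L ^^ n) a)" using K by simp
    also have "\<dots> \<le> K * (K ^ n * norm a)" using K Suc by (intro mult_left_mono) auto
    finally show ?case by (simp add: mult.assoc)
  qed simp
  have "summable (\<lambda>n. inverse (fact n) * (\<bar>t\<bar> * K) ^ n * norm a)"
    by (intro summable_mult2 summable_exp)
  moreover have "norm ((t ^ n / fact n) *\<^sub>R (L ^^ n) a) \<le> inverse (fact n) * (\<bar>t\<bar> * K) ^ n * norm a" for n
    using mult_left_mono[OF b[of n], of "\<bar>t\<bar> ^ n / fact n"]
    by (simp add: power_mult_distrib power_abs divide_inverse abs_mult ac_simps)
  ultimately show ?thesis by (rule summable_comparison_test'[where N = 0])
qed

context
  fixes L :: "real^4 \<Rightarrow> real^4"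
  assumes L: "linear L"
begin

lemma exp_op_zero: "exp_op 0 L a = a"
proof -
  have "exp_op 0 L a = (\<Sum>n. if n = 0 then a else 0)"
    unfolding exp_op_def by (rule suminf_cong) simp
  also have "\<dots> = a" by (subst suminf_finite[of "{0}"]) auto
  finally show ?thesis .
qed

lemma linear_exp_op: "linear (exp_op t L)"
proof
  have l: "linear (L ^^ n)" for n
    by (induction n) (auto simp: linear_ident L id_def comp_def intro: linear_compose[of _ L, unfolded comp_def])
  show "exp_op t L (a + b) = exp_op t L a + exp_op t L b" for a b
    unfolding exp_op_def linear_add[OF l] scaleR_add_right
    by (rule suminf_add[symmetric]) (rule exp_op_summable[OF L])+
  show "exp_op t L (c *\<^sub>R a) = c *\<^sub>R exp_op t L a" for c a
    unfolding exp_op_def linear_scale[OF l] scaleR_left_commute[of _ c]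
    by (rule suminf_scaleR_right[symmetric]) (rule exp_op_summable[OF L])
qed

lemma bounded_linear_exp_op: "bounded_linear (exp_op t L)"
  using linear_exp_op by (simp add: linear_conv_bounded_linear)

lemma exp_op_commute: "L (exp_op t L a) = exp_op t L (L a)"
proof -
  have "L (exp_op t L a) = (\<Sum>n. L ((t ^ n / fact n) *\<^sub>R (L ^^ n) a))"
    unfolding exp_op_def using L by (intro bounded_linear.suminf exp_op_summable[OF L])
      (simp add: linear_conv_bounded_linear)
  also have "\<dots> = exp_op t L (L a)"
    unfolding exp_op_def by (simp add: linear_scale[OF L] funpow_swap1)
  finally show ?thesis .
qed

text \<open>The vector series is differentiated coordinate by coordinate as a scalar power series;
  the coefficient shift \<open>diffs\<close> turns \<open>a\<close> into \<open>L a\<close>.\<close>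

lemma exp_op_has_vector_derivative:
  "((\<lambda>t. exp_op t L a) has_vector_derivative L (exp_op t L a)) (at t)"
proof -
  define c where "c j n = ((L ^^ n) a) $ j / fact n" for j :: 4 and n
  have e: "exp_op s L b $ j = (\<Sum>n. ((L ^^ n) b) $ j / fact n * s ^ n)" for s b j
    unfolding exp_op_def bounded_linear.suminf[OF bounded_linear_vec_nth exp_op_summable[OF L]]
    by (simp add: ac_simps)
  have sm: "summable (\<lambda>n. c j n * s ^ n)" for s j
    using bounded_linear.summable[OF bounded_linear_vec_nth exp_op_summable[OF L, of s a], of j]
    by (simp add: c_def ac_simps)
  have "diffs (c j) = (\<lambda>n. ((L ^^ n) (L a)) $ j / fact n)" for j
    by (auto simp: diffs_def c_def funpow_swap1 divide_simps simp del: of_nat_Suc)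
  then have d: "((\<lambda>t. exp_op t L a $ j) has_real_derivative exp_op t L (L a) $ j) (at t)" for j
    using termdiffs_strong_converges_everywhere[OF sm, of j t] by (simp add: e) (simp add: c_def)
  show ?thesis
    unfolding exp_op_commute has_vector_derivative_def
    by (subst has_derivative_componentwise_within)
      (use d in \<open>auto simp: Basis_vec_def inner_axis has_field_derivative_def mult_commute_abs\<close>)
qed

text \<open>Expanding \<open>y t\<close> in the standard basis leaves finitely many curves
  \<open>exp_op (s t) L (axis i 1)\<close> with scalar coefficients. With \<open>s t = - t\<close>
  and \<open>y\<close> a solution of \<open>y' = L y\<close>, the two terms cancel.\<close>

lemma exp_op_product_rule:
  assumes s: "(s has_real_derivative s') (at t)" and y: "(y has_vector_derivative y') (at t)"
  shows "((\<lambda>t. exp_op (s t) L (y t)) has_vector_derivative exp_op (s t) L (y' + s' *\<^sub>R L (y t))) (at t)"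
proof -
  have eq: "exp_op r L b = (\<Sum>i\<in>UNIV. (b $ i) *\<^sub>R exp_op r L (axis i 1))" for r b
  proof -
    have "exp_op r L b = exp_op r L (\<Sum>i\<in>UNIV. (b $ i) *\<^sub>R axis i 1)"
      using basis_expansion[of b] by (simp add: scalar_mult_eq_scaleR)
    then show ?thesis by (simp add: linear_sum[OF linear_exp_op] linear_scale[OF linear_exp_op])
  qed
  have y_i: "((\<lambda>t. y t $ i) has_real_derivative y' $ i) (at t)" for i
    using bounded_linear.has_vector_derivative[OF bounded_linear_vec_nth y]
    by (simp add: has_real_derivative_iff_has_vector_derivative)
  have e: "((\<lambda>t. exp_op (s t) L b) has_vector_derivative s' *\<^sub>R L (exp_op (s t) L b)) (at t)" for b
    using vector_diff_chain_at[OF s[unfolded has_real_derivative_iff_has_vector_derivative]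
        exp_op_has_vector_derivative]
    by (simp add: comp_def)
  have "((\<lambda>t. \<Sum>i\<in>UNIV. (y t $ i) *\<^sub>R exp_op (s t) L (axis i 1)) has_vector_derivative
      (\<Sum>i\<in>UNIV. (y t $ i) *\<^sub>R s' *\<^sub>R L (exp_op (s t) L (axis i 1)) + (y' $ i) *\<^sub>R exp_op (s t) L (axis i 1))) (at t)"
    by (intro has_vector_derivative_sum has_vector_derivative_scaleR y_i e)
  moreover have "(\<Sum>i\<in>UNIV. (y t $ i) *\<^sub>R s' *\<^sub>R L (exp_op (s t) L (axis i 1)) + (y' $ i) *\<^sub>R exp_op (s t) L (axis i 1))
      = exp_op (s t) L (y' + s' *\<^sub>R L (y t))"
  proof -
    have "(\<Sum>i\<in>UNIV. (y t $ i) *\<^sub>R s' *\<^sub>R L (exp_op (s t) L (axis i 1)))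
        = s' *\<^sub>R L (\<Sum>i\<in>UNIV. (y t $ i) *\<^sub>R exp_op (s t) L (axis i 1))"
      by (simp add: linear_sum[OF L] linear_scale[OF L] scaleR_sum_right mult.commute)
    then show ?thesis
      by (simp add: sum.distrib eq[symmetric] exp_op_commute linear_add[OF linear_exp_op] linear_scale[OF linear_exp_op])
  qed
  ultimately show ?thesis by (simp add: eq[symmetric])
qed

end

section \<open>Linear differential equations and the laws of the flow\<close>

lemma has_real_derivative_uminus: "((\<lambda>t. - t) has_real_derivative - 1) (at t)"
  by (auto intro!: derivative_eq_intros)

lemma has_vector_derivative_zero_imp_const:
  fixes f :: "real \<Rightarrow> 'a::real_normed_vector"
  assumes "\<And>t. (f has_vector_derivative 0) (at t)"
  shows "f s = f t"
  using has_derivative_zero_constant[of UNIV f] assms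
  by (auto simp: has_vector_derivative_def)

lemma exp_op_inverse:
  assumes "linear L"
  shows "exp_op (- t) L (exp_op t L a) = a"
proof -
  have "((\<lambda>t. exp_op (- t) L (exp_op t L a)) has_vector_derivative 0) (at t)" for t
    using exp_op_product_rule[OF assms has_real_derivative_uminus exp_op_has_vector_derivative[OF assms], of a t]
    by (simp add: linear_0[OF linear_exp_op[OF assms]])
  then show ?thesis
    using has_vector_derivative_zero_imp_const[of "\<lambda>t. exp_op (- t) L (exp_op t L a)" t 0]
    by (simp add: exp_op_zero[OF assms])
qed

text \<open>\<open>exp_op (- t) L\<close> is an integrating factor: applied to a solution it gives a
  constant, and \<open>exp_op_inverse\<close> undoes it.\<close>

lemma linear_ode_unique:
  assumes "linear L" and "\<And>t. (y has_vector_derivative L (y t)) (at t)"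
  shows "y t = exp_op t L (y 0)"
proof -
  have "((\<lambda>t. exp_op (- t) L (y t)) has_vector_derivative 0) (at t)" for t
    using exp_op_product_rule[OF assms(1) has_real_derivative_uminus assms(2), of t]
    by (simp add: linear_0[OF linear_exp_op[OF assms(1)]])
  then have "exp_op (- t) L (y t) = y 0"
    using has_vector_derivative_zero_imp_const[of "\<lambda>t. exp_op (- t) L (y t)" t 0]
    by (simp add: exp_op_zero[OF assms(1)])
  then show ?thesis
    using exp_op_inverse[OF assms(1), of "- t" "y t"] by simp
qed

lemma exp_op_add:
  assumes "linear L"
  shows "exp_op (s + t) L a = exp_op s L (exp_op t L a)"
proof -
  have "((\<lambda>s. exp_op (s + t) L a) has_vector_derivative L (exp_op (s + t) L a)) (at s)" for s
    using vector_diff_chain_at[of "\<lambda>s. s + t" 1 s "\<lambda>s. exp_op s L a",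
        OF _ exp_op_has_vector_derivative[OF assms]]
    by (simp add: comp_def has_vector_derivative_add_const)
  from linear_ode_unique[OF assms this, of s] show ?thesis by simp
qed

text \<open>For \<open>R = theta_a\<close> and \<open>s = -1\<close> this is the reversal of the
  flow by the involution.\<close>

lemma exp_op_intertwine:
  assumes "linear L" "linear R" and R: "\<And>a. R (L a) = s *\<^sub>R L (R a)"
  shows "R (exp_op t L a) = exp_op (s * t) L (R a)"
proof -
  have e: "((\<lambda>t. R (exp_op t L a)) has_vector_derivative s *\<^sub>R L (R (exp_op t L a))) (at t)" for t
    using bounded_linear.has_vector_derivative[of R, OF _ exp_op_has_vector_derivative[OF assms(1)]] assms(2)
    by (simp add: R linear_conv_bounded_linear)
  have m: "((\<lambda>t. - (s * t)) has_real_derivative - s) (at t)" for t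
    by (auto intro!: derivative_eq_intros)
  have "((\<lambda>t. exp_op (- (s * t)) L (R (exp_op t L a))) has_vector_derivative 0) (at t)" for t
    using exp_op_product_rule[OF assms(1) m e, of t]
    by (simp add: linear_0[OF linear_exp_op[OF assms(1)]])
  then have "exp_op (- (s * t)) L (R (exp_op t L a)) = R a"
    using has_vector_derivative_zero_imp_const[of "\<lambda>t. exp_op (- (s * t)) L (R (exp_op t L a))" t 0]
    by (simp add: exp_op_zero[OF assms(1)])
  then show ?thesis
    using exp_op_inverse[OF assms(1), of "- (s * t)" "R (exp_op t L a)"] by simp
qed

section \<open>Coset coordinates\<close>

lemma vec2_eq_iff: "x = y \<longleftrightarrow> x $ 1 = y $ 1 \<and> x $ 2 = y $ 2"
  for x y :: "'a^2"
  by (simp add: vec_eq_iff forall_2)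

lemma inner_2: "x \<bullet> y = x $ 1 * y $ 1 + x $ 2 * y $ 2"
  for x y :: "real^2"
  by (simp add: inner_vec_def sum_2)

lemma a_plus_join [simp]: "a_plus (a_join x y) = x"
  and a_minus_join [simp]: "a_minus (a_join x y) = y"
  by (simp_all add: a_plus_def a_minus_def a_join_def vec2_eq_iff)

lemma a_join_plus_minus [simp]: "a_join (a_plus a) (a_minus a) = a"
  by (simp add: a_plus_def a_minus_def a_join_def vec_eq_iff forall_4)

lemma linear_a_plus: "linear a_plus" and linear_a_minus: "linear a_minus"
  by (auto intro!: linearI simp: a_plus_def a_minus_def vec2_eq_iff)

lemmas a_plus_simps [simp] = linear_add[OF linear_a_plus] linear_scale[OF linear_a_plus]
  linear_0[OF linear_a_plus]
lemmas a_minus_simps [simp] = linear_add[OF linear_a_minus] linear_scale[OF linear_a_minus]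
  linear_0[OF linear_a_minus]

lemmas bounded_linear_a_plus = linear_a_plus[unfolded linear_conv_bounded_linear]
lemmas bounded_linear_a_minus = linear_a_minus[unfolded linear_conv_bounded_linear]

lemma a_vec_eq_iff: "a = b \<longleftrightarrow> a_plus a = a_plus b \<and> a_minus a = a_minus b"
  by (metis a_join_plus_minus)

lemma a_join_add [simp]: "a_join x y + a_join x' y' = a_join (x + x') (y + y')"
  and a_join_scaleR [simp]: "c *\<^sub>R a_join x y = a_join (c *\<^sub>R x) (c *\<^sub>R y)"
  and a_join_zero [simp]: "a_join 0 0 = 0"
  by (simp_all add: a_vec_eq_iff)

lemma omega0_eq: "omega0 a b = a_plus a \<bullet> a_minus b - a_minus a \<bullet> a_plus b"
  by (simp add: omega0_def inner_2 a_plus_def a_minus_def)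

lemma omega0_add [simp]: "omega0 (a + b) c = omega0 a c + omega0 b c"
  "omega0 a (b + c) = omega0 a b + omega0 a c"
  by (simp_all add: omega0_eq inner_simps)

lemma omega0_scaleR [simp]: "omega0 (r *\<^sub>R a) b = r * omega0 a b" "omega0 a (r *\<^sub>R b) = r * omega0 a b"
  by (simp_all add: omega0_eq right_diff_distrib)

lemma omega0_refl [simp]: "omega0 a a = 0"
  by (simp add: omega0_eq inner_commute)

lemma omega0_zero [simp]: "omega0 0 a = 0" "omega0 a 0 = 0"
  by (simp_all add: omega0_eq)

lemma bounded_bilinear_omega0: "bounded_bilinear omega0"
  by (rule bilinear_conv_bounded_bilinear[THEN iffD1], rule bilinear_by_eqs) simp_all

section \<open>The group law and coordinates on the cosets of \<open>G_plus\<close>\<close>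

lemma G_grp_mult:
  "(z, a, t) \<otimes>\<^bsub>G_grp L\<^esub> (z', a', t') =
     (z + z' + omega0 (exp_op (- t') L a) a' / 2, exp_op (- t') L a + a', t + t')"
  by (simp add: G_grp_def H5_def flow_def)

lemma G_grp_one: "\<one>\<^bsub>G_grp L\<^esub> = 0"
  by (simp add: G_grp_def zero_prod_def)

lemma G_grp_carrier [simp]: "carrier (G_grp L) = UNIV"
  by (simp add: G_grp_def)

lemma G_plus_eq: "G_plus = range (\<lambda>y. (0, a_join y 0, 0))"
proof -
  have "a_minus a = 0 \<longleftrightarrow> (\<exists>y. a = a_join y 0)" for a
    by (metis a_join_plus_minus a_minus_join)
  then show ?thesis by (auto simp: G_plus_def)
qed

text \<open>Every coset contains exactly one element with \<open>a\<^sub>+ = 0\<close>.\<close>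

definition coset_rep :: "xcoords \<Rightarrow> gcoords" where
  "coset_rep = (\<lambda>(v, x, u). (v, a_join 0 x, u))"

lemma linear_coset_rep: "linear coset_rep"
  by (auto intro!: linearI simp: coset_rep_def)

text \<open>The formula of \<open>Phi\<close> lifted to the group, with \<open>omega0\<close> of the
  two summands evaluated as a scalar product.\<close>

definition coset_coords :: "gcoords \<Rightarrow> xcoords" where
  "coset_coords = (\<lambda>(z, a, t). (z + a_plus a \<bullet> a_minus a / 2, a_minus a, t))"

lemma coset_coords_rep [simp]: "coset_coords (coset_rep q) = q"
  by (cases q) (simp add: coset_rep_def coset_coords_def)

lemma smooth_coset_coords: "smooth_on UNIV coset_coords"
proof -
  have l: "bounded_linear (\<lambda>p :: gcoords. a_plus (fst (snd p)))"
    "bounded_linear (\<lambda>p :: gcoords. a_minus (fst (snd p)))"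
    by (auto intro!: bounded_linear_compose[OF bounded_linear_a_plus]
        bounded_linear_compose[OF bounded_linear_a_minus]
        bounded_linear_compose[OF bounded_linear_fst] bounded_linear_snd)
  have "smooth_on UNIV (\<lambda>p :: gcoords. (fst p + (1/2) *\<^sub>R (a_plus (fst (snd p)) \<bullet> a_minus (fst (snd p))),
      a_minus (fst (snd p)), snd (snd p)))"
    by (intro smooth_on_Pair smooth_on_add smooth_on_const l[THEN smooth_on_bounded_linear]
        bounded_bilinear.smooth_on_prod[OF bounded_bilinear_scaleR]
        bounded_bilinear.smooth_on_prod[OF bounded_bilinear_inner]
        bounded_linear_fst[THEN smooth_on_bounded_linear]
        bounded_linear_compose[OF bounded_linear_snd bounded_linear_snd, THEN smooth_on_bounded_linear])
  then show ?thesis by (simp add: coset_coords_def case_prod_unfold)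
qed

lemma coset_coords_has_derivative_0:
  "(coset_coords has_derivative (\<lambda>(z, a, t). (z, a_minus a, t))) (at 0)"
proof -
  have l: "((\<lambda>p :: gcoords. a_plus (fst (snd p))) has_derivative (\<lambda>p. a_plus (fst (snd p)))) (at 0)"
    "((\<lambda>p :: gcoords. a_minus (fst (snd p))) has_derivative (\<lambda>p. a_minus (fst (snd p)))) (at 0)"
    by (auto intro!: bounded_linear_imp_has_derivative bounded_linear_compose[OF bounded_linear_a_plus]
        bounded_linear_compose[OF bounded_linear_a_minus]
        bounded_linear_compose[OF bounded_linear_fst] bounded_linear_snd)
  show ?thesis
    unfolding coset_coords_def case_prod_unfold
    by (rule derivative_eq_intros l refl | simp)+
qed

context
  fixes L :: "real^4 \<Rightarrow> real^4"
  assumes L: "linear L"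
begin

lemma proj_eq:
  "proj L (z, a, t) = range (\<lambda>y. (z - a_minus a \<bullet> y / 2, a + a_join y 0, t))"
  unfolding proj_def l_coset_def G_plus_eq
  by (simp add: UNION_singleton_eq_range image_image G_grp_mult exp_op_zero[OF L] omega0_eq)

text \<open>Along a coset the change \<open>- a_minus a \<bullet> y / 2\<close> of \<open>z\<close>
  cancels the change of \<open>a_plus a \<bullet> a_minus a / 2\<close>, so the image is a singleton
  and \<open>the_elem\<close> returns its element.\<close>

lemma Phi_proj: "Phi (proj L p) = coset_coords p"
proof -
  obtain z a t where p: "p = (z, a, t)" by (cases p) auto
  have "(\<lambda>(z, a, t). (z + omega0 (a_join (a_plus a) 0) (a_join 0 (a_minus a)) / 2, a_minus a, t)) `
      proj L p = {coset_coords p}"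
    unfolding p proj_eq coset_coords_def
    by (auto simp: image_image omega0_eq inner_simps inner_commute add_divide_distrib)
  then show ?thesis by (simp add: Phi_def)
qed

lemma proj_coset_rep: "proj L (coset_rep (coset_coords p)) = proj L p"
proof -
  obtain z a t where p: "p = (z, a, t)" by (cases p) auto
  \<comment> \<open>Shifting the parameter by \<open>a_plus a\<close> makes it the new
    \<open>a_plus\<close>; parameter 0 is then the representative.\<close>
  have s: "range (\<lambda>y. y - a_plus a) = UNIV"
    by (rule surjI[where f = "\<lambda>y. y + a_plus a"]) simp
  have "proj L p = (\<lambda>y. (z - a_minus a \<bullet> y / 2, a + a_join y 0, t)) ` range (\<lambda>y. y - a_plus a)"
    unfolding p proj_eq s ..
  also have "\<dots> = proj L (coset_rep (coset_coords p))"
    unfolding p coset_coords_def coset_rep_def prod.case proj_eq image_image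
    by (intro image_cong refl)
      (simp add: a_vec_eq_iff inner_diff_right inner_commute[of "a_plus a"] diff_divide_distrib)
  finally show ?thesis by simp
qed

lemma proj_eq_iff: "proj L p = proj L q \<longleftrightarrow> coset_coords p = coset_coords q"
  by (metis Phi_proj proj_coset_rep)

lemma X_space_eq: "X_space L = range (proj L)"
  by (auto simp: X_space_def LCOSETS_def proj_def)

lemma bij_betw_Phi: "bij_betw Phi (X_space L) UNIV"
  by (rule bij_betw_byWitness[where f' = "\<lambda>q. proj L (coset_rep q)"])
    (auto simp: X_space_eq Phi_proj proj_coset_rep)

lemma inv_Phi: "inv_into (X_space L) Phi q = proj L (coset_rep q)"
  using bij_betw_Phi by (intro inv_into_f_eq) (auto simp: bij_betw_def X_space_eq Phi_proj)

text \<open>The linear map \<open>coset_rep\<close> is a global section, so one smooth lift serves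
  near every point.\<close>

lemma diffeo_Phi: "diffeo_X L Phi"
  unfolding diffeo_X_def smooth_from_X_def smooth_into_X_def inv_Phi Phi_proj
  using bij_betw_Phi smooth_coset_coords smooth_on_linear[OF linear_coset_rep]
  by (metis open_UNIV UNIV_I)

text \<open>By \<open>PB\<close> the pairing of the two summands is multiplied by the same
  \<open>s\<close> as \<open>z\<close>. Hence the terms in the coset parameter \<open>y\<close>
  cancel and a coset is mapped into a single coset. The cases \<open>s = 1\<close> and
  \<open>s = -1\<close> are those without and with a factor theta.\<close>

lemma aut_act_eq:
  assumes \<phi>: "\<And>z a t. \<phi> (z, a, t) = (s * z, a_join (P (a_plus a)) (B (a_minus a)), s * t)"
    and PB: "\<And>x y. P x \<bullet> B y = s * (x \<bullet> y)"
  shows "aut_act L \<phi> (v, x, u) = (s * v, B x, s * u)"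
proof -
  let ?C = "proj L (coset_rep (v, x, u))" and ?D = "proj L (coset_rep (s * v, B x, s * u))"
  have "coset_coords (\<phi> g) = (s * v, B x, s * u)" if "g \<in> ?C" for g
  proof -
    have "g \<in> range (\<lambda>y. (v - x \<bullet> y / 2, a_join y x, u))"
      using that by (simp add: coset_rep_def proj_eq)
    then obtain y where g: "g = (v - x \<bullet> y / 2, a_join y x, u)" by blast
    show ?thesis
      by (simp add: g \<phi> coset_coords_def PB inner_commute[of x y] right_diff_distrib)
  qed
  then have "proj L (\<phi> g) = ?D" if "g \<in> ?C" for g
    using that by (simp add: proj_eq_iff)
  moreover have "?C \<noteq> {}"
    by (simp add: coset_rep_def proj_eq)
  ultimately have "(\<lambda>g. proj L (\<phi> g)) ` ?C = {?D}"
    by blast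
  then show ?thesis
    by (simp add: aut_act_def in_coords_def inv_Phi Phi_proj)
qed

end

section \<open>The point symmetry\<close>

text \<open>The functional equation transports the velocity from 0 to \<open>t\<close> by
  \<open>B t\<close>, which fixes \<open>d\<close>; so the velocity is \<open>d\<close> everywhere.
  The operators \<open>B s\<close> accommodate the twist of the vector component by the
  flow.\<close>

lemma one_parameter_curve:
  fixes f :: "real \<Rightarrow> 'a::real_normed_vector"
  assumes f: "\<And>r s. f (r + s) = B s (f r) + f s" "f 0 = 0"
    and B: "\<And>s. bounded_linear (B s)" "\<And>s. B s d = d"
    and d: "(f has_vector_derivative d) (at 0)"
  shows "f s = s *\<^sub>R d"
proof -
  have "((\<lambda>x. f x - x *\<^sub>R d) has_vector_derivative 0) (at t)" for t
  proof -
    have e: "B t (f (x - t)) + f t = f x" for x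
      using f(1)[of "x - t" t] by simp
    \<comment> \<open>The point 0 is written \<open>t - t\<close> to match the chain rule for
      \<open>x - t\<close> at \<open>t\<close>.\<close>
    have "((\<lambda>r. B t (f r) + f t) has_vector_derivative B t d) (at (t - t))"
      using bounded_linear.has_vector_derivative[OF B(1) d, of t]
      by (simp add: has_vector_derivative_add_const)
    then have "((\<lambda>x. B t (f (x - t)) + f t) has_vector_derivative B t d) (at t)"
      using vector_diff_chain_at[of "\<lambda>x. x - t" 1 t "\<lambda>r. B t (f r) + f t" "B t d"]
      by (simp add: comp_def has_vector_derivative_diff_const)
    then have "(f has_vector_derivative d) (at t)"
      by (simp add: e B(2))
    from has_vector_derivative_diff[OF this, of "\<lambda>x. x *\<^sub>R d" d]
    show ?thesis
      by (simp add: has_vector_derivative_def has_derivative_scaleR_left)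
  qed
  from has_vector_derivative_zero_imp_const[of "\<lambda>x. f x - x *\<^sub>R d", OF this, of s 0]
  show ?thesis using f(2) by simp
qed

definition G_theta :: "gcoords \<Rightarrow> gcoords" where
  "G_theta = (\<lambda>(z, a, t). (- z, theta_a a, - t))"

lemma theta_a_eq: "theta_a a = a_join (a_plus a) (- a_minus a)"
  by (simp add: theta_a_def a_plus_def a_minus_def a_join_def)

lemma linear_theta_a: "linear theta_a"
  by (auto intro!: linearI simp: theta_a_eq)

lemma linear_G_theta: "linear G_theta"
  by (auto intro!: linearI simp: G_theta_def linear_add[OF linear_theta_a] linear_scale[OF linear_theta_a])

lemma G_theta_involution: "G_theta (G_theta p) = p"
  by (cases p) (simp add: G_theta_def theta_a_eq)

locale symplectic_endomorphism =
  fixes L :: "real^4 \<Rightarrow> real^4"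
  assumes linear: "linear L"
    and symplectic: "omega0 (L a) b = - omega0 a (L b)"
begin

lemma omega0_exp_op: "omega0 (exp_op t L a) (exp_op t L b) = omega0 a b"
proof -
  have "((\<lambda>t. omega0 (exp_op t L a) (exp_op t L b)) has_vector_derivative 0) (at t)" for t
    using bounded_bilinear.has_vector_derivative[OF bounded_bilinear_omega0
        exp_op_has_vector_derivative[OF linear, where t = t and a = a]
        exp_op_has_vector_derivative[OF linear, where t = t and a = b]]
    by (simp add: symplectic)
  from has_vector_derivative_zero_imp_const[OF this, of t 0]
  show ?thesis by (simp add: exp_op_zero[OF linear])
qed

text \<open>The two bracketings differ by applying \<open>exp_op (- t'')\<close> to both arguments
  of \<open>omega0\<close>, so invariance under the flow is what makes them agree.\<close>

lemma G_grp_assoc: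
  "(p \<otimes>\<^bsub>G_grp L\<^esub> q) \<otimes>\<^bsub>G_grp L\<^esub> r = p \<otimes>\<^bsub>G_grp L\<^esub> (q \<otimes>\<^bsub>G_grp L\<^esub> r)"
proof -
  obtain z a t where p: "p = (z, a, t)" by (cases p) auto
  obtain z' a' t' where q: "q = (z', a', t')" by (cases q) auto
  obtain z'' a'' t'' where r: "r = (z'', a'', t'')" by (cases r) auto
  have e: "exp_op (- t') L (exp_op (- t'') L b) = exp_op (- t' - t'') L b"
    "exp_op (- t'') L (exp_op (- t') L b) = exp_op (- t' - t'') L b" for b
    by (simp_all only: exp_op_add[OF linear, symmetric] diff_conv_add_uminus add.commute)
  have "omega0 (exp_op (- t' - t'') L a) (exp_op (- t'') L a') = omega0 (exp_op (- t') L a) a'"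
    using omega0_exp_op[of "- t''" "exp_op (- t') L a" a'] by (simp add: e)
  then show ?thesis
    by (simp add: p q r G_grp_mult linear_add[OF linear_exp_op[OF linear]] e add_divide_distrib)
qed

lemma l_coset_proj: "p <#\<^bsub>G_grp L\<^esub> proj L q = proj L (p \<otimes>\<^bsub>G_grp L\<^esub> q)"
  by (simp add: proj_def l_coset_def UNION_singleton_eq_range image_image G_grp_assoc)

lemma G_act_eq: "G_act L p q = coset_coords (p \<otimes>\<^bsub>G_grp L\<^esub> coset_rep q)"
  by (simp add: G_act_def in_coords_def inv_Phi[OF linear] l_coset_proj Phi_proj[OF linear])

text \<open>With \<open>b = exp_op (- u) L a\<close>, the group product contributes
  \<open>a_plus b \<bullet> x / 2\<close> through \<open>omega0\<close>, and the coset correction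
  contributes \<open>a_plus b \<bullet> (a_minus b + x) / 2\<close>; the two halves form the full
  shear of \<open>M_aff\<close>.\<close>

lemma G_act_M_aff:
  "G_act L (z, a, t) (v, x, u) = (case M_aff (z, exp_op (- u) L a) (v, x) of (v', x') \<Rightarrow> (v', x', u + t))"
  by (simp add: G_act_eq coset_rep_def coset_coords_def G_grp_mult M_aff_def omega0_eq inner_add_right
      add_divide_distrib add.commute)

text \<open>A smooth endomorphism of the group is determined by its differential at the identity, since
  \<open>(z, a, t)\<close> is the product of \<open>(0, 0, t)\<close> and \<open>(z, a, 0)\<close>, each of which lies on a one-parameter
  subgroup.\<close>

lemma hom_eq_G_theta:
  assumes hom: "\<phi> \<in> hom (G_grp L) (G_grp L)" and D: "(\<phi> has_derivative G_theta) (at 0)"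
  shows "\<phi> = G_theta"
proof
  fix p :: gcoords
  let ?z = "\<lambda>p. fst (\<phi> p)" and ?a = "\<lambda>p. fst (snd (\<phi> p))" and ?t = "\<lambda>p. snd (snd (\<phi> p))"
  have \<phi>: "\<phi> p = (?z p, ?a p, ?t p)" for p by simp
  have mult: "?z (p \<otimes>\<^bsub>G_grp L\<^esub> q) = ?z p + ?z q + omega0 (exp_op (- ?t q) L (?a p)) (?a q) / 2"
    "?a (p \<otimes>\<^bsub>G_grp L\<^esub> q) = exp_op (- ?t q) L (?a p) + ?a q"
    "?t (p \<otimes>\<^bsub>G_grp L\<^esub> q) = ?t p + ?t q" for p q
  proof -
    have "\<phi> (p \<otimes>\<^bsub>G_grp L\<^esub> q) = \<phi> p \<otimes>\<^bsub>G_grp L\<^esub> \<phi> q"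
      using hom by (auto simp: hom_def simp del: split_paired_All)
    then show "?z (p \<otimes>\<^bsub>G_grp L\<^esub> q) = ?z p + ?z q + omega0 (exp_op (- ?t q) L (?a p)) (?a q) / 2"
      "?a (p \<otimes>\<^bsub>G_grp L\<^esub> q) = exp_op (- ?t q) L (?a p) + ?a q"
      "?t (p \<otimes>\<^bsub>G_grp L\<^esub> q) = ?t p + ?t q"
      by (metis G_grp_mult \<phi> fst_conv snd_conv)+
  qed
  note E0 = exp_op_zero[OF linear]
  have "(0::gcoords) \<otimes>\<^bsub>G_grp L\<^esub> 0 = 0"
    by (simp add: zero_prod_def G_grp_mult E0)
  then have t0: "?t 0 = 0" and a0: "?a 0 = 0" and z0: "?z 0 = 0"
    using mult[of 0 0] by (simp_all add: E0)
  have curve: "((\<lambda>s. F (\<phi> (s *\<^sub>R d))) has_vector_derivative F (G_theta d)) (at 0)"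
    if "bounded_linear F" for F :: "gcoords \<Rightarrow> 'b::real_normed_vector" and d
  proof -
    have "((\<lambda>s. s *\<^sub>R d) has_vector_derivative d) (at 0)"
      by (simp add: has_vector_derivative_def has_derivative_scaleR_left)
    then have "((\<lambda>s. \<phi> (s *\<^sub>R d)) has_vector_derivative G_theta d) (at 0)"
      using has_derivative_compose[of "\<lambda>s. s *\<^sub>R d" "\<lambda>s. s *\<^sub>R d" 0 UNIV \<phi> G_theta] D
      by (simp add: has_vector_derivative_def linear_scale[OF linear_G_theta])
    then show ?thesis
      by (rule bounded_linear.has_vector_derivative[OF that])
  qed
  note bl = bounded_linear_fst bounded_linear_snd
    bounded_linear_compose[OF bounded_linear_fst bounded_linear_snd]
    bounded_linear_compose[OF bounded_linear_snd bounded_linear_snd]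
  \<comment> \<open>Lines in the Heisenberg part are subgroups because
    \<open>omega0 a a = 0\<close>; on the time axis the vector part is zero.\<close>
  have sub: "(r + s) *\<^sub>R d = (r *\<^sub>R d) \<otimes>\<^bsub>G_grp L\<^esub> (s *\<^sub>R d)"
    if "d = (z, a, 0) \<or> d = (0, 0, t)" for r s d z a t
    using that linear_0[OF linear_exp_op[OF linear]] by (auto simp: G_grp_mult E0 algebra_simps)
  obtain z a t where p: "p = (z, a, t)" by (cases p) auto
  define b where "b = (z, a, 0 :: real)"
  define c where "c = (0 :: real, 0 :: real^4, t)"
  \<comment> \<open>The order is \<open>t\<close>, \<open>a\<close>, \<open>z\<close>: the law for
    \<open>?t\<close> is additive, \<open>?t\<close> governs the exponential in the law for
    \<open>?a\<close>, and \<open>?a\<close> enters the \<open>omega0\<close> term of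
    \<open>?z\<close>.\<close>
  have tt: "?t (s *\<^sub>R d) = s *\<^sub>R snd (snd (G_theta d))" if d: "d = b \<or> d = c" for d s
  proof (rule one_parameter_curve[where B = "\<lambda>_ x. x"])
    show "?t ((r + s) *\<^sub>R d) = ?t (r *\<^sub>R d) + ?t (s *\<^sub>R d)" for r s
      using d sub unfolding b_def c_def by (metis mult(3))
  qed (auto simp: t0 bounded_linear_ident intro: curve bl)
  have tb: "?t (s *\<^sub>R b) = 0" for s
    by (simp add: tt) (simp add: b_def G_theta_def)
  \<comment> \<open>As \<open>?t\<close> vanishes along \<open>b\<close>, the exponential is the
    identity here.\<close>
  have ab: "?a (s *\<^sub>R b) = s *\<^sub>R fst (snd (G_theta b))" for s
  proof (rule one_parameter_curve[where B = "\<lambda>_ x. x"])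
    show "?a ((r + s) *\<^sub>R b) = ?a (r *\<^sub>R b) + ?a (s *\<^sub>R b)" for r s
      using sub[of b z a 0 r s] by (simp add: mult tb E0 b_def[symmetric])
  qed (auto simp: a0 bounded_linear_ident intro: curve bl)
  \<comment> \<open>All values of \<open>?a\<close> along \<open>b\<close> are now multiples of one
    vector, so the \<open>omega0\<close> term is zero.\<close>
  have zb: "?z (s *\<^sub>R b) = s *\<^sub>R fst (G_theta b)" for s
  proof (rule one_parameter_curve[where B = "\<lambda>_ x. x"])
    show "?z ((r + s) *\<^sub>R b) = ?z (r *\<^sub>R b) + ?z (s *\<^sub>R b)" for r s
      using sub[of b z a 0 r s] by (simp add: mult tb ab E0 b_def[symmetric])
  qed (auto simp: z0 bounded_linear_ident intro: curve bl)
  have c0: "fst (snd (G_theta c)) = 0" "fst (G_theta c) = 0"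
    by (simp_all add: c_def G_theta_def theta_a_eq)
  \<comment> \<open>Here the twist by the flow is present, but the velocity 0 is fixed by every
    linear map. The form \<open>s *\<^sub>R 0\<close> matches
    \<open>one_parameter_curve\<close>.\<close>
  have ac: "?a (s *\<^sub>R c) = s *\<^sub>R 0" for s
  proof (rule one_parameter_curve[where B = "\<lambda>s. exp_op (- ?t (s *\<^sub>R c)) L"])
    show "?a ((r + s) *\<^sub>R c) = exp_op (- ?t (s *\<^sub>R c)) L (?a (r *\<^sub>R c)) + ?a (s *\<^sub>R c)" for r s
      using sub[of c 0 0 t r s] by (simp add: mult c_def[symmetric])
    show "((\<lambda>s. ?a (s *\<^sub>R c)) has_vector_derivative 0) (at 0)"
      using curve[OF bl(3), of c] by (simp add: c0)
  qed (auto simp: a0 bounded_linear_exp_op[OF linear] linear_0[OF linear_exp_op[OF linear]])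
  have zc: "?z (s *\<^sub>R c) = s *\<^sub>R 0" for s
  proof (rule one_parameter_curve[where B = "\<lambda>_ x. x"])
    show "?z ((r + s) *\<^sub>R c) = ?z (r *\<^sub>R c) + ?z (s *\<^sub>R c)" for r s
      using sub[of c 0 0 t r s] ac by (simp add: mult c_def[symmetric])
    show "((\<lambda>s. ?z (s *\<^sub>R c)) has_vector_derivative 0) (at 0)"
      using curve[OF bl(1), of c] by (simp add: c0)
  qed (auto simp: z0 bounded_linear_ident)
  have "\<phi> b = G_theta b"
    using tb[of 1] ab[of 1] zb[of 1] by (simp add: prod_eq_iff) (simp add: b_def G_theta_def)
  moreover have "\<phi> c = G_theta c"
    using tt[of c 1] ac[of 1] zc[of 1] by (simp add: prod_eq_iff c0)
  moreover have "p = c \<otimes>\<^bsub>G_grp L\<^esub> b"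
    by (simp add: p b_def c_def G_grp_mult E0)
  ultimately have "\<phi> p = G_theta c \<otimes>\<^bsub>G_grp L\<^esub> G_theta b"
    using hom by (auto simp: hom_def simp del: split_paired_All)
  also have "\<dots> = G_theta p"
    by (simp add: p b_def c_def G_theta_def G_grp_mult theta_a_eq E0)
  finally show "\<phi> p = G_theta p" .
qed

text \<open>\<open>theta_a\<close> reverses the flow, in accordance with the sign of
  \<open>t\<close>, and changes the sign of \<open>omega0\<close>, in accordance with the sign of
  \<open>z\<close>.\<close>

lemma G_theta_iso:
  assumes anti: "\<And>a. theta_a (L a) = - L (theta_a a)"
  shows "G_theta \<in> iso (G_grp L) (G_grp L)"
proof -
  have e: "theta_a (exp_op t L a) = exp_op (- t) L (theta_a a)" for t a
    using exp_op_intertwine[OF linear linear_theta_a, of "-1" t a] by (simp add: anti)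
  have o: "omega0 (theta_a a) (theta_a b) = - omega0 a b" for a b
    by (simp add: omega0_eq theta_a_eq)
  have "G_theta (p \<otimes>\<^bsub>G_grp L\<^esub> q) = G_theta p \<otimes>\<^bsub>G_grp L\<^esub> G_theta q" for p q
    using e[of "- snd (snd q)" "fst (snd p)"] o[of "exp_op (- snd (snd q)) L (fst (snd p))" "fst (snd q)"]
    by (cases p, cases q) (simp add: G_theta_def G_grp_mult linear_add[OF linear_theta_a])
  moreover have "bij G_theta"
    by (rule o_bij[of G_theta]) (auto simp: G_theta_involution)
  ultimately show ?thesis by (simp add: iso_def hom_def)
qed

lemma theta_G_eq:
  assumes anti: "\<And>a. theta_a (L a) = - L (theta_a a)"
    and "surj \<iota>" and \<iota>: "\<And>\<xi>. \<iota> (invol T \<xi>) = G_theta (\<iota> \<xi>)"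
  shows "theta_G L T \<iota> = G_theta"
  unfolding theta_G_def G_grp_one
proof (rule the_equality)
  show "G_theta \<in> iso (G_grp L) (G_grp L) \<and> smooth_on UNIV G_theta \<and>
     (\<exists>D. (G_theta has_derivative D) (at 0) \<and> (\<forall>\<xi>. D (\<iota> \<xi>) = \<iota> (invol T \<xi>)))"
    using G_theta_iso[OF anti] smooth_on_linear[OF linear_G_theta]
      bounded_linear_imp_has_derivative[OF linear_G_theta[unfolded linear_conv_bounded_linear]]
    by (intro conjI exI[of _ G_theta]) (simp_all add: \<iota>)
next
  fix \<phi>
  assume *: "\<phi> \<in> iso (G_grp L) (G_grp L) \<and> smooth_on UNIV \<phi> \<and>
     (\<exists>D. (\<phi> has_derivative D) (at 0) \<and> (\<forall>\<xi>. D (\<iota> \<xi>) = \<iota> (invol T \<xi>)))"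
  then obtain D where D: "(\<phi> has_derivative D) (at 0)" "\<And>\<xi>. D (\<iota> \<xi>) = \<iota> (invol T \<xi>)" by blast
  \<comment> \<open>The condition on \<open>D\<close> concerns only the values of
    \<open>\<iota>\<close>, which exhaust the tangent space.\<close>
  have "D = G_theta"
    using \<open>surj \<iota>\<close> by (metis D(2) \<iota> ext surjD)
  then show "\<phi> = G_theta"
    using * D(1) hom_eq_G_theta by (auto simp: iso_def)
qed

end

section \<open>The invariant metric\<close>

definition plane_wave_metric :: "(real^2 \<Rightarrow> real^2 \<Rightarrow> real) \<Rightarrow> (real^2 \<Rightarrow> real^2) \<Rightarrow> metric" where
  "plane_wave_metric g S = (\<lambda>(v, x, u) (dv, dx, du) (dv', dx', du').
     du * dv' + dv * du' + g dx dx' + (S x \<bullet> x) * du * du')"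

text \<open>\<open>g_T\<close> encodes \<open>g\<close> as the inverse of \<open>T\<close> without
  forming an inverse; symmetry and injectivity of \<open>T\<close> follow from it.\<close>

locale plane_wave =
  fixes L :: "real^4 \<Rightarrow> real^4" and S T :: "real^2 \<Rightarrow> real^2" and g :: "real^2 \<Rightarrow> real^2 \<Rightarrow> real"
  assumes L_eq: "L a = a_join (S (a_minus a)) (T (a_plus a))"
    and linear_S: "linear S" and linear_T: "linear T" and bilinear_g: "bilinear g"
    and S_sym: "S x \<bullet> y = S y \<bullet> x" and g_sym: "g x y = g y x"
    and g_T: "g (T x) y = x \<bullet> y"
begin

lemma T_sym: "T x \<bullet> y = T y \<bullet> x"
  using g_T[of y "T x"] g_T[of x "T y"] g_sym[of "T x" "T y"] by (simp add: inner_commute)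

sublocale symplectic_endomorphism L
proof (rule symplectic_endomorphism.intro)
  show "linear L"
    by (auto intro!: linearI simp: L_eq linear_add[OF linear_S] linear_add[OF linear_T]
        linear_scale[OF linear_S] linear_scale[OF linear_T])
  show "omega0 (L a) b = - omega0 a (L b)" for a b
    using S_sym[of "a_minus a" "a_minus b"] T_sym[of "a_plus a" "a_plus b"]
    by (simp add: L_eq omega0_eq inner_commute)
qed

text \<open>\<open>L\<close> exchanges the two summands, on which \<open>theta_a\<close> has
  opposite eigenvalues.\<close>

lemma L_anti_theta: "theta_a (L a) = - L (theta_a a)"
  by (simp add: L_eq a_vec_eq_iff theta_a_eq linear_neg[OF linear_S] linear_neg[OF linear_a_plus]
      linear_neg[OF linear_a_minus])

lemma g_nondegenerate:
  assumes "\<And>y. g x y = 0"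
  shows "x = 0"
proof -
  have "inj T"
    unfolding linear_injective_0[OF linear_T]
    by (metis g_T bilinear_lzero[OF bilinear_g] inner_eq_zero_iff)
  then obtain w where "x = T w"
    using linear_injective_imp_surjective[OF linear_T] by (metis surjD)
  then show ?thesis
    using assms g_T by (metis inner_eq_zero_iff linear_0[OF linear_T])
qed

abbreviation "h \<equiv> plane_wave_metric g S"

lemma h_nondegenerate:
  assumes "\<And>\<eta>. h q \<xi> \<eta> = 0"
  shows "\<xi> = 0"
proof -
  obtain v x u where q: "q = (v, x, u)" by (cases q) auto
  obtain dv dx du where \<xi>: "\<xi> = (dv, dx, du)" by (cases \<xi>) auto
  \<comment> \<open>Test vectors along \<open>v\<close>, \<open>x\<close>, \<open>u\<close> isolate
    \<open>du\<close>, \<open>dx\<close>, \<open>dv\<close> in turn.\<close>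
  have "du = 0"
    using assms[of "(1, 0, 0)"] by (simp add: q \<xi> plane_wave_metric_def bilinear_rzero[OF bilinear_g])
  moreover have "dx = 0"
    using assms[of "(0, _, 0)"] \<open>du = 0\<close> by (intro g_nondegenerate) (simp add: q \<xi> plane_wave_metric_def)
  ultimately show ?thesis
    using assms[of "(0, 0, 1)"] by (simp add: q \<xi> plane_wave_metric_def bilinear_rzero[OF bilinear_g] zero_prod_def)
qed

lemma pseudo_riemannian_h: "pseudo_riemannian h"
  unfolding pseudo_riemannian_def
proof (intro conjI allI impI)
  note bg = bilinear_ladd[OF bilinear_g] bilinear_radd[OF bilinear_g]
    bilinear_lmul[OF bilinear_g] bilinear_rmul[OF bilinear_g]
  show "bilinear (h q)" for q
    by (rule bilinear_by_eqs)
      (auto simp: plane_wave_metric_def case_prod_unfold bg algebra_simps)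
  show "h q \<xi> \<eta> = h q \<eta> \<xi>" for q \<xi> \<eta>
    by (simp add: plane_wave_metric_def case_prod_unfold g_sym[of "fst (snd \<xi>)"])
  show "\<xi> = 0" if "\<forall>\<eta>. h q \<xi> \<eta> = 0" for q \<xi>
    using that h_nondegenerate by blast
  show "smooth_on UNIV (\<lambda>q. h q \<xi> \<eta>)" for \<xi> \<eta>
  proof -
    obtain dv dx du where \<xi>: "\<xi> = (dv, dx, du)" by (cases \<xi>) auto
    obtain dv' dx' du' where \<eta>: "\<eta> = (dv', dx', du')" by (cases \<eta>) auto
    have l: "linear (\<lambda>q :: xcoords. fst (snd q))" "linear (\<lambda>q :: xcoords. S (fst (snd q)))"
      by (auto intro!: linearI simp: linear_add[OF linear_S] linear_scale[OF linear_S])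
    have "smooth_on UNIV (\<lambda>q :: xcoords. (du * dv' + dv * du' + g dx dx')
        + (S (fst (snd q)) \<bullet> fst (snd q)) *\<^sub>R (du * du'))"
      by (intro smooth_on_add smooth_on_const l[THEN smooth_on_linear]
        bounded_bilinear.smooth_on_prod[OF bounded_bilinear_scaleR]
        bounded_bilinear.smooth_on_prod[OF bounded_bilinear_inner])
    then show ?thesis
      by (simp add: \<xi> \<eta> plane_wave_metric_def case_prod_unfold mult.assoc)
  qed
qed

lemma preserves_metric_G_act: "preserves_metric h (G_act L p)"
  unfolding preserves_metric_def
proof (intro allI)
  fix q :: xcoords
  obtain z a t where p: "p = (z, a, t)" by (cases p) auto
  obtain v x u where q: "q = (v, x, u)" by (cases q) auto
  define b where "b u = exp_op (- u) L a" for u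
  have F: "G_act L p = (\<lambda>q. (fst q + a_plus (b (snd (snd q))) \<bullet> fst (snd q) + z
      + a_plus (b (snd (snd q))) \<bullet> a_minus (b (snd (snd q))) / 2,
      fst (snd q) + a_minus (b (snd (snd q))), snd (snd q) + t))"
    by (auto simp: fun_eq_iff p G_act_M_aff M_aff_def b_def)
  have b': "(b has_vector_derivative - L (b u)) (at u)"
    using vector_diff_chain_at[of uminus "-1" u "\<lambda>s. exp_op s L a"]
      exp_op_has_vector_derivative[OF linear, of a "- u"] has_real_derivative_uminus[of u]
    by (simp add: comp_def b_def[abs_def] has_real_derivative_iff_has_vector_derivative)
  define m where "m = a_minus (b u)"
  define n where "n = a_plus (b u)"
  have Lb: "a_plus (- L (b u)) = - S m" "a_minus (- L (b u)) = - T n"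
    by (simp_all add: L_eq m_def n_def linear_neg[OF linear_a_plus] linear_neg[OF linear_a_minus])
  have s: "((\<lambda>q :: xcoords. snd (snd q)) has_derivative (\<lambda>d. snd (snd d))) (at q)"
    by (auto intro!: derivative_eq_intros)
  have bq: "((\<lambda>q :: xcoords. b (snd (snd q))) has_derivative (\<lambda>d. snd (snd d) *\<^sub>R - L (b u))) (at q)"
    using has_derivative_compose[OF s, of b] b' by (simp add: q has_vector_derivative_def)
  have bp: "((\<lambda>q :: xcoords. a_plus (b (snd (snd q)))) has_derivative (\<lambda>d. snd (snd d) *\<^sub>R - S m)) (at q)"
    using bounded_linear.has_derivative[OF bounded_linear_a_plus bq] by (simp only: a_plus_simps Lb)
  have bm: "((\<lambda>q :: xcoords. a_minus (b (snd (snd q)))) has_derivative (\<lambda>d. snd (snd d) *\<^sub>R - T n)) (at q)"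
    using bounded_linear.has_derivative[OF bounded_linear_a_minus bq] by (simp only: a_minus_simps Lb)
  \<comment> \<open>The last two terms of the first component differentiate
    \<open>a_plus b \<bullet> x\<close> and \<open>a_plus b \<bullet> a_minus b / 2\<close> along
    the flow, using \<open>Lb\<close> and the symmetry of the inner product.\<close>
  define D where "D = (\<lambda>(dv, dx, du). (dv + n \<bullet> dx - du * (S m \<bullet> x) - du * (S m \<bullet> m + T n \<bullet> n) / 2,
      dx - du *\<^sub>R T n, du))"
  have D: "(G_act L p has_derivative D) (at q)"
    unfolding F D_def case_prod_unfold
    by (rule derivative_eq_intros bp bm refl zero_neq_numeral[symmetric])+
      (simp add: q m_def[symmetric] n_def[symmetric] fun_eq_iff inner_commute[of n] field_simps)
  have DF: "frechet_derivative (G_act L p) (at q) = D"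
    using frechet_derivative_at[OF D] by simp
  have Fq: "G_act L p q = (v + n \<bullet> x + z + n \<bullet> m / 2, x + m, u + t)"
    by (simp add: F q m_def n_def)
  have "h (G_act L p q) (D \<xi>) (D \<eta>) = h q \<xi> \<eta>" for \<xi> \<eta>
  proof -
    obtain dv dx du where \<xi>: "\<xi> = (dv, dx, du)" by (cases \<xi>) auto
    obtain dv' dx' du' where \<eta>: "\<eta> = (dv', dx', du')" by (cases \<eta>) auto
    \<comment> \<open>The mixed terms cancel the shear in \<open>dv\<close>;
      \<open>T n \<bullet> n\<close> here and the terms of
      \<open>S (x + m) \<bullet> (x + m)\<close> beyond \<open>S x \<bullet> x\<close> cancel the
      \<open>du\<close> contributions to \<open>dv\<close>.\<close>
    have "g (dx - du *\<^sub>R T n) (dx' - du' *\<^sub>R T n)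
        = g dx dx' - du' * (n \<bullet> dx) - du * (n \<bullet> dx') + du * du' * (T n \<bullet> n)"
      by (simp add: bilinear_lsub[OF bilinear_g] bilinear_rsub[OF bilinear_g] bilinear_lmul[OF bilinear_g]
          bilinear_rmul[OF bilinear_g] g_T g_sym[of dx "T n"] inner_commute[of n "T n"] algebra_simps)
    moreover have "S (x + m) \<bullet> (x + m) = S x \<bullet> x + 2 * (S m \<bullet> x) + S m \<bullet> m"
      using S_sym[of x m] by (simp add: linear_add[OF linear_S] inner_simps)
    ultimately show ?thesis
      unfolding q Fq[unfolded q] D_def \<xi> \<eta> plane_wave_metric_def prod.case
      by (simp only:) (simp add: field_simps)
  qed
  then show "G_act L p differentiable (at q) \<and>
      (\<forall>\<xi> \<eta>. h (G_act L p q) (frechet_derivative (G_act L p) (at q) \<xi>)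
        (frechet_derivative (G_act L p) (at q) \<eta>) = h q \<xi> \<eta>)"
    using D by (auto simp: DF differentiable_def)
qed

text \<open>At the base point \<open>x = 0\<close>, so the \<open>du\<close> square term is absent,
  and the differential of the projection just forgets \<open>a_plus\<close>.\<close>

lemma is_metric_of_X_h:
  assumes "\<And>\<xi> \<eta> z a t z' a' t'. \<xi> \<in> minus_part R \<Longrightarrow> \<eta> \<in> minus_part R \<Longrightarrow> \<iota> \<xi> = (z, a, t) \<Longrightarrow>
    \<iota> \<eta> = (z', a', t') \<Longrightarrow> form R \<xi> \<eta> = t * z' + z * t' + g (a_minus a) (a_minus a')"
  shows "is_metric_of_X L R \<iota> h"
proof -
  have D: "frechet_derivative coset_coords (at 0) = (\<lambda>(z, a, t). (z, a_minus a, t))"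
    using frechet_derivative_at[OF coset_coords_has_derivative_0] by simp
  have "h (coset_coords 0) (case \<iota> \<xi> of (z, a, t) \<Rightarrow> (z, a_minus a, t))
      (case \<iota> \<eta> of (z, a, t) \<Rightarrow> (z, a_minus a, t)) = form R \<xi> \<eta>"
    if "\<xi> \<in> minus_part R" "\<eta> \<in> minus_part R" for \<xi> \<eta>
    using assms[OF that]
    by (simp add: coset_coords_def zero_prod_def plane_wave_metric_def split: prod.split)
  then show ?thesis
    by (simp add: is_metric_of_X_def pseudo_riemannian_h preserves_metric_G_act G_grp_one D Let_def
        Phi_proj[OF linear])
qed

section \<open>Isometries given by linear maps in the coordinates\<close>

lemma isometry_h:
  assumes F: "\<And>v x u. F (v, x, u) = (s * v, B x, s * u)" and "s * s = 1" and B: "linear B"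
    and g: "\<And>x y. g (B x) (B y) = g x y" and S: "\<And>x. S (B x) \<bullet> B x = S x \<bullet> x"
  shows "isometry h F"
proof -
  have s: "(s * a) * (s * b) = a * b" "c * (s * a) * (s * b) = c * a * b" for a b c
    using \<open>s * s = 1\<close> by algebra+
  have lin: "linear F"
    by (auto intro!: linearI simp: F linear_add[OF B] linear_scale[OF B] algebra_simps)
  have inv: "h (F q) (F \<xi>) (F \<eta>) = h q \<xi> \<eta>" for q \<xi> \<eta>
    by (cases q, cases \<xi>, cases \<eta>) (simp add: F plane_wave_metric_def g S s)
  \<comment> \<open>A kernel vector would be orthogonal to everything, since \<open>F\<close>
    preserves \<open>h\<close>.\<close>
  have "inj F"
    unfolding linear_injective_0[OF lin]
  proof (intro allI impI)
    fix \<xi> assume "F \<xi> = 0"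
    then have "h 0 \<xi> \<eta> = 0" for \<eta>
      using inv[of 0 \<xi> \<eta>] pseudo_riemannian_h bilinear_lzero by (metis pseudo_riemannian_def)
    then show "\<xi> = 0" by (rule h_nondegenerate)
  qed
  then have bij: "bij F"
    using linear_injective_imp_surjective[OF lin] by (simp add: bij_def)
  then have "linear (inv_into UNIV F)"
    by (simp add: inj_linear_imp_inv_linear[OF lin] bij_is_inj)
  moreover have D: "(F has_derivative F) (at q)" for q
    using lin by (simp add: bounded_linear_imp_has_derivative linear_conv_bounded_linear)
  then have "F differentiable (at q)" "frechet_derivative F (at q) = F" for q
    using frechet_derivative_at[of F F q] unfolding differentiable_def by metis+
  ultimately show ?thesis
    using bij by (auto simp: isometry_def preserves_metric_def smooth_on_linear[OF lin]
        smooth_on_linear inv)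
qed

text \<open>Theta fixes \<open>a_plus\<close> and negates \<open>a_minus\<close>; composing with its
  power therefore keeps \<open>P\<close>, precomposes \<open>B\<close> with \<open>\<delta>\<close>,
  and puts \<open>s = \<delta>\<close> in \<open>aut_act_eq\<close>.\<close>

lemma isometry_aut_act:
  fixes \<iota> :: "'v::euclidean_space \<Rightarrow> gcoords"
  assumes \<phi>: "\<And>z a t. \<phi> (z, a, t) = (z, a_join (P (a_plus a)) (B (a_minus a)), t)"
    and B: "linear B" and PB: "\<And>x y. P x \<bullet> B y = x \<bullet> y"
    and g: "\<And>x y. g (B x) (B y) = g x y" and S: "\<And>x. S (B x) \<bullet> B x = S x \<bullet> x"
    and "\<delta> \<in> {1, -1}" and "surj \<iota>" and \<iota>: "\<And>\<xi>. \<iota> (invol R \<xi>) = G_theta (\<iota> \<xi>)"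
  shows "isometry h (aut_act L (\<phi> \<circ> theta_pow L R \<iota> \<delta>))"
    and "aut_act L (\<phi> \<circ> theta_pow L R \<iota> \<delta>) (v, x, u) = (\<delta> * v, B (\<delta> *\<^sub>R x), \<delta> * u)"
proof -
  have act: "aut_act L (\<phi> \<circ> theta_pow L R \<iota> \<delta>) (v, x, u) = (\<delta> * v, B (\<delta> *\<^sub>R x), \<delta> * u)" for v x u
  proof (rule aut_act_eq[OF linear])
    show "(\<phi> \<circ> theta_pow L R \<iota> \<delta>) (z, a, t) = (\<delta> * z, a_join (P (a_plus a)) (B (\<delta> *\<^sub>R a_minus a)), \<delta> * t)"
      for z a t
      using \<open>\<delta> \<in> {1, -1}\<close> theta_G_eq[OF L_anti_theta \<open>surj \<iota>\<close> \<iota>]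
      by (auto simp: theta_pow_def \<phi> G_theta_def theta_a_eq)
    show "P x \<bullet> B (\<delta> *\<^sub>R y) = \<delta> * (x \<bullet> y)" for x y
      by (simp add: PB)
  qed
  then show "aut_act L (\<phi> \<circ> theta_pow L R \<iota> \<delta>) (v, x, u) = (\<delta> * v, B (\<delta> *\<^sub>R x), \<delta> * u)" .
  show "isometry h (aut_act L (\<phi> \<circ> theta_pow L R \<iota> \<delta>))"
  proof (rule isometry_h[OF act])
    show "\<delta> * \<delta> = 1" using \<open>\<delta> \<in> {1, -1}\<close> by auto
    show "linear (\<lambda>x. B (\<delta> *\<^sub>R x))"
      using linear_compose[OF linear_scale_self B] by (simp add: comp_def)
    show "g (B (\<delta> *\<^sub>R x)) (B (\<delta> *\<^sub>R y)) = g x y" for x y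
      using \<open>\<delta> * \<delta> = 1\<close>
      by (simp add: g bilinear_lmul[OF bilinear_g] bilinear_rmul[OF bilinear_g] mult.assoc[symmetric])
    show "S (B (\<delta> *\<^sub>R x)) \<bullet> B (\<delta> *\<^sub>R x) = S x \<bullet> x" for x
      using \<open>\<delta> * \<delta> = 1\<close> by (simp add: S linear_scale[OF linear_S] mult.assoc[symmetric])
  qed
qed

text \<open>On a fixed level the vector \<open>b\<close> is constant, and
  \<open>M_aff (z, b)\<close> is a shear followed by a translation.\<close>

lemma affine_level_action:
  "\<exists>f. affine_transformation f \<and>
     (\<forall>v x. G_act L (z, a, 0) (v, x, u) = (case f (v, x) of (v', x') \<Rightarrow> (v', x', u)))"
proof (intro exI conjI allI)
  define b where "b = exp_op (- u) L a"
  have "bij (M_aff (z, b))"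
    by (rule bij_betw_byWitness[where f' = "\<lambda>(v, x). (v - a_plus b \<bullet> (x - a_minus b) - z
        - a_plus b \<bullet> a_minus b / 2, x - a_minus b)"]) (auto simp: M_aff_def)
  moreover have "linear (\<lambda>(v, x). (v + a_plus b \<bullet> x, x))"
    by (auto intro!: linearI simp: inner_add_right algebra_simps)
  moreover have "M_aff (z, b) y = (case y of (v, x) \<Rightarrow> (v + a_plus b \<bullet> x, x))
      + (z + a_plus b \<bullet> a_minus b / 2, a_minus b)" for y
    by (cases y) (simp add: M_aff_def)
  ultimately show "affine_transformation (M_aff (z, exp_op (- u) L a))"
    unfolding affine_transformation_def b_def by blast
  show "G_act L (z, a, 0) (v, x, u) = (case M_aff (z, exp_op (- u) L a) (v, x) of (v', x') \<Rightarrow> (v', x', u))"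
    for v x
    by (simp add: G_act_M_aff)
qed

end

lemma (in plane_wave) coset_space_action:
  shows "(\<forall>z a t. Phi (proj L (z, a, t))
       = (z + omega0 (a_join (a_plus a) 0) (a_join 0 (a_minus a)) / 2, a_minus a, t)) \<and>
    diffeo_X L Phi \<and>
    (\<forall>z a t v x u. G_act L (z, a, t) (v, x, u)
       = (case M_aff (z, exp_op (- u) L a) (v, x) of (v', x') \<Rightarrow> (v', x', u + t))) \<and>
    (\<forall>z a u. \<exists>f. affine_transformation f \<and>
       (\<forall>v x. G_act L (z, a, 0) (v, x, u) = (case f (v, x) of (v', x') \<Rightarrow> (v', x', u))))"
  using diffeo_Phi[OF linear] affine_level_action
  by (auto simp: Phi_proj[OF linear] coset_coords_def omega0_eq G_act_M_aff)

section \<open>The spaces \<open>X\<^sub>1\<close>, \<open>X\<^sub>2\<close> and \<open>Y\<close>\<close>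

definition lorentz_form :: "real^2 \<Rightarrow> real^2 \<Rightarrow> real" where
  "lorentz_form x y = - (x$1 * y$1) + x$2 * y$2"

definition T_X :: "real^2 \<Rightarrow> real^2" where
  "T_X x = vector [- (x$1), x$2]"

definition S_X1 :: "real \<Rightarrow> real \<Rightarrow> real \<Rightarrow> real^2 \<Rightarrow> real^2" where
  "S_X1 \<epsilon>1 \<epsilon>2 lam x = vector [- (\<epsilon>1 * x$1), - (\<epsilon>2 * lam\<^sup>2 * x$2)]"

definition S_X2 :: "real \<Rightarrow> real^2 \<Rightarrow> real^2" where
  "S_X2 \<nu> x = vector [(\<nu>\<^sup>2 - 1) * x$1 - 2 * \<nu> * x$2, - (2 * \<nu> * x$1) - (\<nu>\<^sup>2 - 1) * x$2]"

definition form_Y :: "real \<Rightarrow> real \<Rightarrow> real^2 \<Rightarrow> real^2 \<Rightarrow> real" where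
  "form_Y \<epsilon> \<kappa> x y = - (\<epsilon> * (x$1 * y$2 + x$2 * y$1 + \<kappa> * x$2 * y$2))"

definition S_Y :: "real \<Rightarrow> real^2 \<Rightarrow> real^2" where
  "S_Y \<kappa> x = vector [x$2, x$1 - \<kappa> * x$2]"

text \<open>The inverse of the Gram matrix of \<open>form_Y\<close>, with \<open>\<epsilon>\<close>
  in place of its inverse as \<open>\<epsilon> = 1\<close> or
  \<open>\<epsilon> = -1\<close>.\<close>

definition T_Y :: "real \<Rightarrow> real \<Rightarrow> real^2 \<Rightarrow> real^2" where
  "T_Y \<epsilon> \<kappa> x = vector [\<epsilon> * \<kappa> * x$1 - \<epsilon> * x$2, - (\<epsilon> * x$1)]"

lemma plane_wave_X1: "plane_wave (L_X1 \<epsilon>1 \<epsilon>2 lam) (S_X1 \<epsilon>1 \<epsilon>2 lam) T_X lorentz_form"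
  by (intro plane_wave.intro linearI bilinear_by_eqs)
    (auto simp: L_X1_def S_X1_def T_X_def lorentz_form_def a_join_def a_plus_def a_minus_def
      vec2_eq_iff inner_2 algebra_simps)

lemma plane_wave_X2: "plane_wave (L_X2 \<nu>) (S_X2 \<nu>) T_X lorentz_form"
  by (intro plane_wave.intro linearI bilinear_by_eqs)
    (auto simp: L_X2_def S_X2_def T_X_def lorentz_form_def a_join_def a_plus_def a_minus_def
      vec2_eq_iff inner_2 algebra_simps)

lemma plane_wave_Y:
  assumes "\<epsilon> \<in> {1, -1}"
  shows "plane_wave (L_Y \<epsilon> \<kappa>) (S_Y \<kappa>) (T_Y \<epsilon> \<kappa>) (form_Y \<epsilon> \<kappa>)"
  using assms by (intro plane_wave.intro linearI bilinear_by_eqs)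
    (auto simp: L_Y_def S_Y_def T_Y_def form_Y_def a_join_def a_plus_def a_minus_def
      vec2_eq_iff inner_2 algebra_simps)

lemma metric_X1_eq: "metric_X1 \<epsilon>1 \<epsilon>2 lam = plane_wave_metric lorentz_form (S_X1 \<epsilon>1 \<epsilon>2 lam)"
  by (auto simp: fun_eq_iff metric_X1_def plane_wave_metric_def lorentz_form_def S_X1_def inner_2
      power2_eq_square algebra_simps)

lemma metric_X2_eq: "metric_X2 \<nu> = plane_wave_metric lorentz_form (S_X2 \<nu>)"
  by (auto simp: fun_eq_iff metric_X2_def plane_wave_metric_def lorentz_form_def S_X2_def inner_2
      power2_eq_square algebra_simps)

lemma metric_Y_eq: "metric_Y \<epsilon> \<kappa> = plane_wave_metric (form_Y \<epsilon> \<kappa>) (S_Y \<kappa>)"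
  by (auto simp: fun_eq_iff metric_Y_def plane_wave_metric_def form_Y_def S_Y_def inner_2
      power2_eq_square algebra_simps)

lemma is_metric_X1:
  "is_metric_of_X (L_X1 \<epsilon>1 \<epsilon>2 lam) (triple_X1 \<epsilon>1 \<epsilon>2 lam) (ident_X1 lam) (metric_X1 \<epsilon>1 \<epsilon>2 lam)"
  unfolding metric_X1_eq
  by (rule plane_wave.is_metric_of_X_h[OF plane_wave_X1])
    (auto simp: minus_part_def triple_X1_def oscillator_triple_def ident_X1_def theta_a_def diag_form_def
      lorentz_form_def a_minus_def vec_eq_iff forall_4 sum_4)

lemma is_metric_X2: "is_metric_of_X (L_X2 \<nu>) (triple_X2 \<nu>) (ident_X2 \<nu>) (metric_X2 \<nu>)"
  unfolding metric_X2_eq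
  by (rule plane_wave.is_metric_of_X_h[OF plane_wave_X2])
    (auto simp: minus_part_def triple_X2_def oscillator_triple_def ident_X2_def theta_a_def diag_form_def
      lorentz_form_def a_minus_def vec_eq_iff forall_4 sum_4)

text \<open>Solves a triangular system: the \<open>e_2\<close> and \<open>e_3\<close> coefficients
  fix \<open>a$4\<close> and \<open>a$1\<close>, and then the \<open>\<kappa> / 2\<close> shifts can
  be removed from \<open>a$3\<close> and \<open>a$2\<close>.\<close>

lemma ident_Y_eq:
  assumes "\<epsilon> \<in> {1, -1}"
  shows "ident_Y \<epsilon> \<kappa> (s, l) =
    (s$1, vector [- (l$3), s$3 + \<kappa> / 2 * l$3, \<epsilon> * s$2 + \<kappa> / 2 * l$2, - (l$2)], l$1)"
  unfolding ident_Y_def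
proof (rule inv_into_f_eq)
  show "inj (ident_Y_inv \<epsilon> \<kappa>)"
    using lie_iso_ident_Y(2)[OF assms] by (rule bij_is_inj)
  show "ident_Y_inv \<epsilon> \<kappa> (s$1, vector [- (l$3), s$3 + \<kappa> / 2 * l$3, \<epsilon> * s$2 + \<kappa> / 2 * l$2, - (l$2)], l$1) = (s, l)"
    using assms by (auto simp: ident_Y_inv_def vec_eq_iff forall_3 axis_def algebra_simps)
qed simp

lemma surj_ident_X1: "lam > 0 \<Longrightarrow> surj (ident_X1 lam)"
  \<comment> \<open>The signs do not occur in \<open>ident_X1\<close>; 1 is a sample value.\<close>
  using lie_iso_ident_X1(2)[of 1 1] by (simp add: bij_is_surj)

lemma surj_ident_X2: "\<nu> > 0 \<Longrightarrow> surj (ident_X2 \<nu>)"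
  by (rule bij_is_surj) (rule lie_iso_ident_X2(2))

lemma surj_ident_Y: "\<epsilon> \<in> {1, -1} \<Longrightarrow> surj (ident_Y \<epsilon> \<kappa>)"
  unfolding ident_Y_def by (intro inj_imp_surj_inv bij_is_inj lie_iso_ident_Y(2))

lemma is_metric_Y:
  assumes "\<epsilon> \<in> {1, -1}"
  shows "is_metric_of_X (L_Y \<epsilon> \<kappa>) (triple_Y \<epsilon> \<kappa>) (ident_Y \<epsilon> \<kappa>) (metric_Y \<epsilon> \<kappa>)"
  unfolding metric_Y_eq
proof (rule plane_wave.is_metric_of_X_h[OF plane_wave_Y[OF assms]])
  fix \<xi> \<eta> z a t z' a' t'
  assume m: "\<xi> \<in> minus_part (triple_Y \<epsilon> \<kappa>)" "\<eta> \<in> minus_part (triple_Y \<epsilon> \<kappa>)"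
    and i: "ident_Y \<epsilon> \<kappa> \<xi> = (z, a, t)" "ident_Y \<epsilon> \<kappa> \<eta> = (z', a', t')"
  obtain s l s' l' where e: "\<xi> = (s, l)" "\<eta> = (s', l')" by (cases \<xi>, cases \<eta>) auto
  have "t = l$1" "t' = l'$1" "z = s$1" "z' = s'$1" "a$4 = - l$2" "a'$4 = - l'$2"
    "a$3 = \<epsilon> * s$2 + \<kappa> / 2 * l$2" "a'$3 = \<epsilon> * s'$2 + \<kappa> / 2 * l'$2"
    using i[symmetric] by (simp_all add: e ident_Y_eq[OF assms])
  moreover have "s$3 = 0" "l$3 = 0" "s'$3 = 0" "l'$3 = 0"
    using m by (simp_all add: e minus_part_def triple_Y_def theta_l_def inner_vec_def sum_3 vec_eq_iff
        forall_3 axis_def)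
  \<comment> \<open>The two shifts by \<open>\<kappa> / 2\<close> in \<open>a$3\<close> and
    \<open>a'$3\<close> cancel the \<open>\<kappa>\<close> term of \<open>form_Y\<close>, leaving
    the dual pairing.\<close>
  ultimately show "form (triple_Y \<epsilon> \<kappa>) \<xi> \<eta> = t * z' + z * t' + form_Y \<epsilon> \<kappa> (a_minus a) (a_minus a')"
    using assms by (auto simp: e triple_Y_def form_Y_def a_minus_def inner_vec_def sum_3 algebra_simps)
qed

lemma ident_X1_invol: "ident_X1 lam (invol (triple_X1 \<epsilon>1 \<epsilon>2 lam) \<xi>) = G_theta (ident_X1 lam \<xi>)"
  by (cases \<xi>) (simp add: triple_X1_def oscillator_triple_def ident_X1_def G_theta_def theta_a_def
      vec_eq_iff forall_4)

lemma ident_X2_invol: "ident_X2 \<nu> (invol (triple_X2 \<nu>) \<xi>) = G_theta (ident_X2 \<nu> \<xi>)"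
  by (cases \<xi>) (simp add: triple_X2_def oscillator_triple_def ident_X2_def G_theta_def theta_a_def
      vec_eq_iff forall_4)

lemma ident_Y_invol:
  "\<epsilon> \<in> {1, -1} \<Longrightarrow> ident_Y \<epsilon> \<kappa> (invol (triple_Y \<epsilon> \<kappa>) \<xi>) = G_theta (ident_Y \<epsilon> \<kappa> \<xi>)"
  by (cases \<xi>) (simp add: ident_Y_eq triple_Y_def theta_l_def inner_vec_def sum_3 axis_def G_theta_def
      theta_a_def vec_eq_iff forall_4)

text \<open>Moving \<open>A\<close> across the inner product cancels the contragredient. This
  supplies the pairing condition of \<open>aut_act_eq\<close> for \<open>matrix_aut\<close>.\<close>

lemma inner_matrix_inv_transpose:
  fixes A :: "real^'n^'n"
  assumes "invertible A"
  shows "(matrix_inv (transpose A) *v x) \<bullet> (A *v y) = x \<bullet> y"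
proof -
  have "(matrix_inv (transpose A) *v x) \<bullet> (A *v y) = (transpose A *v (matrix_inv (transpose A) *v x)) \<bullet> y"
    by (simp add: dot_lmul_matrix[symmetric])
  also have "transpose A *v (matrix_inv (transpose A) *v x) = x"
  proof -
    have "invertible (transpose A)"
      using assms by (simp add: invertible_det_nz)
    then have "transpose A ** matrix_inv (transpose A) = mat 1"
      unfolding invertible_def matrix_inv_def by (metis (mono_tags, lifting) someI_ex)
    then show ?thesis by (simp only: matrix_vector_mul_assoc matrix_vector_mul_lid)
  qed
  finally show ?thesis .
qed

lemma diag2_mult: "diag2 \<delta>1 \<delta>2 *v x = vector [\<delta>1 * x$1, \<delta>2 * x$2]"
  by (simp add: diag2_def vec2_eq_iff matrix_vector_mult_def sum_2)

lemma invertible_diag2: "\<delta>1 \<noteq> 0 \<Longrightarrow> \<delta>2 \<noteq> 0 \<Longrightarrow> invertible (diag2 \<delta>1 \<delta>2)"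
  by (simp add: invertible_det_nz det_2 diag2_def)

text \<open>Polarisation of the quadratic condition defining \<open>O11\<close>.\<close>

lemma O11_lorentz_form:
  assumes "A \<in> O11"
  shows "lorentz_form (A *v x) (A *v y) = lorentz_form x y"
proof -
  have q: "lorentz_form (A *v x) (A *v x) = lorentz_form x x" for x
    using assms by (simp add: O11_def lorentz_form_def power2_eq_square)
  show ?thesis
    using q[of "x + y"] q[of x] q[of y]
    by (simp add: lorentz_form_def matrix_vector_right_distrib algebra_simps)
qed

lemma O11_invertible:
  assumes "A \<in> O11"
  shows "invertible A"
proof -
  have "x = 0" if "A *v x = 0" for x
  proof -
    have "lorentz_form x y = 0" for y
      using O11_lorentz_form[OF assms, of x y] that by (simp add: lorentz_form_def)
    \<comment> \<open>A kernel vector lies in the radical of the form; any \<open>plane_wave\<close>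
      instance with \<open>lorentz_form\<close> shows that this radical is zero.\<close>
    then show "x = 0" by (rule plane_wave.g_nondegenerate[OF plane_wave_X2])
  qed
  then show ?thesis
    by (simp add: invertible_left_inverse matrix_left_invertible_ker)
qed

section \<open>The automorphisms in P as isometries\<close>

context plane_wave
begin

lemma isometry_matrix_aut:
  fixes \<iota> :: "'v::euclidean_space \<Rightarrow> gcoords"
  assumes "invertible A" and "\<And>x y. g (A *v x) (A *v y) = g x y"
    and "\<And>x. S (A *v x) \<bullet> (A *v x) = S x \<bullet> x"
    and "\<delta> \<in> {1, -1}" and "surj \<iota>" and "\<And>\<xi>. \<iota> (invol R \<xi>) = G_theta (\<iota> \<xi>)"
  shows "isometry h (aut_act L (matrix_aut A \<circ> theta_pow L R \<iota> \<delta>))"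
    and "aut_act L (matrix_aut A \<circ> theta_pow L R \<iota> \<delta>) (v, x, u) = (\<delta> * v, A *v (\<delta> *\<^sub>R x), \<delta> * u)"
proof -
  note * = isometry_aut_act[where P = "\<lambda>x. matrix_inv (transpose A) *v x" and B = "\<lambda>x. A *v x"
      and \<phi> = "matrix_aut A", OF _ matrix_vector_mul_linear inner_matrix_inv_transpose[OF assms(1)] assms(2-6)]
  show "isometry h (aut_act L (matrix_aut A \<circ> theta_pow L R \<iota> \<delta>))"
    by (rule *) (simp add: matrix_aut_def)
  show "aut_act L (matrix_aut A \<circ> theta_pow L R \<iota> \<delta>) (v, x, u) = (\<delta> * v, A *v (\<delta> *\<^sub>R x), \<delta> * u)"
    by (rule *) (simp add: matrix_aut_def)
qed

lemma isometry_sign_aut: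
  fixes \<iota> :: "'v::euclidean_space \<Rightarrow> gcoords"
  assumes "\<delta>1 \<in> {1, -1}" and "\<delta>2 \<in> {1, -1}" and "surj \<iota>" and "\<And>\<xi>. \<iota> (invol R \<xi>) = G_theta (\<iota> \<xi>)"
  defines "F \<equiv> aut_act L (sign_aut \<delta>1 \<circ> theta_pow L R \<iota> \<delta>2)"
  shows "isometry h F" and "F (v, x, u) = (\<delta>2 * v, (\<delta>1 * \<delta>2) *\<^sub>R x, \<delta>2 * u)"
proof -
  have \<delta>: "\<delta>1 * (\<delta>1 * r) = r" for r
    using assms(1) by auto
  have \<phi>: "sign_aut \<delta>1 (z, a, t) = (z, a_join (\<delta>1 *\<^sub>R a_plus a) (\<delta>1 *\<^sub>R a_minus a), t)" for z a t
    by (simp add: sign_aut_def a_vec_eq_iff)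
  note * = isometry_aut_act[where P = "\<lambda>x. \<delta>1 *\<^sub>R x" and B = "\<lambda>x. \<delta>1 *\<^sub>R x",
      OF \<phi> linear_scale_self _ _ _ assms(2-4)]
  show "isometry h F"
    unfolding F_def
    by (rule *) (simp_all add: \<delta> bilinear_lmul[OF bilinear_g] bilinear_rmul[OF bilinear_g] linear_scale[OF linear_S])
  show "F (v, x, u) = (\<delta>2 * v, (\<delta>1 * \<delta>2) *\<^sub>R x, \<delta>2 * u)"
    unfolding F_def
    by (subst *) (simp_all add: \<delta> bilinear_lmul[OF bilinear_g] bilinear_rmul[OF bilinear_g] linear_scale[OF linear_S])
qed

end

lemma X1_diagonal_symmetry:
  fixes \<epsilon>1 \<epsilon>2 :: real
  assumes "lam > 0" and \<delta>: "\<delta>1 \<in> {1, -1}" "\<delta>2 \<in> {1, -1}" "\<delta>3 \<in> {1, -1}"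
  defines "F \<equiv> aut_act (L_X1 \<epsilon>1 \<epsilon>2 lam) (matrix_aut (diag2 \<delta>1 \<delta>2) \<circ>
    theta_pow (L_X1 \<epsilon>1 \<epsilon>2 lam) (triple_X1 \<epsilon>1 \<epsilon>2 lam) (ident_X1 lam) \<delta>3)"
  shows "isometry (metric_X1 \<epsilon>1 \<epsilon>2 lam) F"
    and "F (v, x, u) = (\<delta>3 * v, vector [\<delta>1 * \<delta>3 * x$1, \<delta>2 * \<delta>3 * x$2], \<delta>3 * u)"
proof -
  have inv: "invertible (diag2 \<delta>1 \<delta>2)"
    using \<delta> by (intro invertible_diag2) auto
  have inv_form: "lorentz_form (diag2 \<delta>1 \<delta>2 *v x) (diag2 \<delta>1 \<delta>2 *v y) = lorentz_form x y"
    "S_X1 \<epsilon>1 \<epsilon>2 lam (diag2 \<delta>1 \<delta>2 *v x) \<bullet> (diag2 \<delta>1 \<delta>2 *v x) = S_X1 \<epsilon>1 \<epsilon>2 lam x \<bullet> x" for x y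
    using \<delta> by (auto simp: diag2_mult lorentz_form_def S_X1_def inner_2)
  note * = plane_wave.isometry_matrix_aut[OF plane_wave_X1 inv inv_form \<delta>(3) surj_ident_X1[OF assms(1)]
      ident_X1_invol]
  show "isometry (metric_X1 \<epsilon>1 \<epsilon>2 lam) F"
    unfolding F_def metric_X1_eq by (rule *)
  show "F (v, x, u) = (\<delta>3 * v, vector [\<delta>1 * \<delta>3 * x$1, \<delta>2 * \<delta>3 * x$2], \<delta>3 * u)"
    unfolding F_def by (simp add: * diag2_mult mult.assoc)
qed

lemma X1_boost_symmetry:
  assumes l: "lam = 1" "\<epsilon>1 = - \<epsilon>2" and A: "A \<in> O11"
  shows "isometry (metric_X1 \<epsilon>1 \<epsilon>2 lam) (aut_act (L_X1 \<epsilon>1 \<epsilon>2 lam) (matrix_aut A))"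
    and "aut_act (L_X1 \<epsilon>1 \<epsilon>2 lam) (matrix_aut A) (v, x, u) = (v, A *v x, u)"
proof -
  \<comment> \<open>In this case the coefficient of the \<open>du\<close> square is a multiple of
    the Lorentz form itself, hence invariant under all of \<open>O11\<close> and not only under sign
    changes.\<close>
  have S: "S_X1 \<epsilon>1 \<epsilon>2 lam x \<bullet> x = \<epsilon>1 * lorentz_form x x" for x
    by (simp add: l S_X1_def lorentz_form_def inner_2 algebra_simps)
  have inv_S: "S_X1 \<epsilon>1 \<epsilon>2 lam (A *v x) \<bullet> (A *v x) = S_X1 \<epsilon>1 \<epsilon>2 lam x \<bullet> x" for x
    by (simp add: S O11_lorentz_form[OF A])
  \<comment> \<open>With \<open>\<delta> = 1\<close> the factor \<open>theta_pow\<close> is the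
    identity, so the general statement covers \<open>matrix_aut A\<close> alone.\<close>
  have \<delta>: "(1::real) \<in> {1, -1}" and "lam > 0" using l by auto
  note * = plane_wave.isometry_matrix_aut[OF plane_wave_X1 O11_invertible[OF A] O11_lorentz_form[OF A]
      inv_S \<delta> surj_ident_X1[OF \<open>lam > 0\<close>] ident_X1_invol]
  show "isometry (metric_X1 \<epsilon>1 \<epsilon>2 lam) (aut_act (L_X1 \<epsilon>1 \<epsilon>2 lam) (matrix_aut A))"
    using *(1) by (simp add: metric_X1_eq theta_pow_def)
  show "aut_act (L_X1 \<epsilon>1 \<epsilon>2 lam) (matrix_aut A) (v, x, u) = (v, A *v x, u)"
    using *(2) by (simp add: theta_pow_def)
qed

theorem proposition4p11:
  fixes \<epsilon>1 \<epsilon>2 \<epsilon> \<kappa> lam \<nu> :: real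
  assumes "\<epsilon>1 \<in> {1, -1}" and "\<epsilon>2 \<in> {1, -1}" and "\<epsilon> \<in> {1, -1}" and "\<kappa> \<in> {1, -1}"
    and "lam > 0" and "\<nu> > 0"
  shows "(\<forall>L \<in> {L_X1 \<epsilon>1 \<epsilon>2 lam, L_X2 \<nu>, L_Y \<epsilon> \<kappa>}.
            (\<forall>z a t. Phi (proj L (z, a, t))
               = (z + omega0 (a_join (a_plus a) 0) (a_join 0 (a_minus a)) / 2, a_minus a, t)) \<and>
            diffeo_X L Phi \<and>
            (\<forall>z a t v x u. G_act L (z, a, t) (v, x, u)
               = (case M_aff (z, exp_op (- u) L a) (v, x) of (v', x') \<Rightarrow> (v', x', u + t))) \<and>
            (\<forall>z a u. \<exists>f. affine_transformation f \<and>
               (\<forall>v x. G_act L (z, a, 0) (v, x, u) = (case f (v, x) of (v', x') \<Rightarrow> (v', x', u)))))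
       \<and>
         (let L = L_X1 \<epsilon>1 \<epsilon>2 lam; T = triple_X1 \<epsilon>1 \<epsilon>2 lam; \<iota> = ident_X1 lam; h = metric_X1 \<epsilon>1 \<epsilon>2 lam in
            is_metric_of_X L T \<iota> h \<and>
            (\<forall>\<delta>1\<in>{1, -1}. \<forall>\<delta>2\<in>{1, -1}. \<forall>\<delta>3\<in>{1, -1}.
               let F = aut_act L (matrix_aut (diag2 \<delta>1 \<delta>2) \<circ> theta_pow L T \<iota> \<delta>3) in
               isometry h F \<and>
               (\<forall>v x u. F (v, x, u) = (\<delta>3 * v, vector [\<delta>1 * \<delta>3 * x$1, \<delta>2 * \<delta>3 * x$2], \<delta>3 * u))) \<and>
            (lam = 1 \<and> \<epsilon>1 = - \<epsilon>2 \<longrightarrow>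
               (\<forall>A\<in>O11. let F = aut_act L (matrix_aut A) in
                  isometry h F \<and> (\<forall>v x u. F (v, x, u) = (v, A *v x, u)))))
       \<and>
         (let L = L_X2 \<nu>; T = triple_X2 \<nu>; \<iota> = ident_X2 \<nu>; h = metric_X2 \<nu> in
            is_metric_of_X L T \<iota> h \<and>
            (\<forall>\<delta>1\<in>{1, -1}. \<forall>\<delta>2\<in>{1, -1}.
               let F = aut_act L (sign_aut \<delta>1 \<circ> theta_pow L T \<iota> \<delta>2) in
               isometry h F \<and>
               (\<forall>v x u. F (v, x, u) = (\<delta>2 * v, (\<delta>1 * \<delta>2) *\<^sub>R x, \<delta>2 * u))))
       \<and>
         (let L = L_Y \<epsilon> \<kappa>; T = triple_Y \<epsilon> \<kappa>; \<iota> = ident_Y \<epsilon> \<kappa>; h = metric_Y \<epsilon> \<kappa> in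
            is_metric_of_X L T \<iota> h \<and>
            (\<forall>\<delta>1\<in>{1, -1}. \<forall>\<delta>2\<in>{1, -1}.
               let F = aut_act L (sign_aut \<delta>1 \<circ> theta_pow L T \<iota> \<delta>2) in
               isometry h F \<and>
               (\<forall>v x u. F (v, x, u) = (\<delta>2 * v, (\<delta>1 * \<delta>2) *\<^sub>R x, \<delta>2 * u))))"
proof -
  note action = plane_wave.coset_space_action[OF plane_wave_X1]
    plane_wave.coset_space_action[OF plane_wave_X2]
    plane_wave.coset_space_action[OF plane_wave_Y[OF assms(3)]]
  note X2 = plane_wave.isometry_sign_aut[OF plane_wave_X2 _ _ surj_ident_X2[OF assms(6)]
      ident_X2_invol, folded metric_X2_eq]
  note Y = plane_wave.isometry_sign_aut[OF plane_wave_Y[OF assms(3)] _ _ surj_ident_Y[OF assms(3)]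
      ident_Y_invol[OF assms(3)], folded metric_Y_eq]
  show ?thesis
    unfolding Let_def
    apply (intro conjI)
    subgoal by (intro ballI, elim insertE emptyE; hypsubst; rule action)
    subgoal by (rule is_metric_X1)
    subgoal by (intro ballI conjI allI; rule X1_diagonal_symmetry[OF assms(5)]; assumption)
    subgoal by (intro impI ballI conjI allI; elim conjE; rule X1_boost_symmetry; assumption)
    subgoal by (rule is_metric_X2)
    subgoal by (intro ballI conjI allI; rule X2; assumption)
    subgoal by (rule is_metric_Y[OF assms(3)])
    subgoal by (intro ballI conjI allI; rule Y; assumption)
    done
qed

end
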